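(* Let $T:D(T)\subseteq X\to X$ be a linear mapping and let $C\in L(X)$ be an injective mapping such that $R(C)\subseteq D_\infty(T)$ and $T^kC\in L(X)$ for all $k\in\mathbb N$. Suppose that exactly one of the following two conditions holds: (i) $X$ is a Banach space and $\sum_{k=1}^\infty\frac1{\|T^kC\|}<\infty$; (ii) $X$ is a complex Hilbert space and $\sum_{k=1}^\infty\frac1{\|T^kC\|^2}<\infty$. Then there exists $x\in X$ such that $\lim_{k\to\infty}\|T^kCx\|=\infty$.
   Context: $X$ is a non-trivial space over $\mathbb K\in\{\mathbb R,\mathbb C\}$. $L(X)$ is the space of bounded linear operators on $X$ with operator norm $\|\cdot\|$, $R(C)$ is the range of $C$, and $D_\infty(T)=\bigcap_{n\in\mathbb N}D(T^n)$. *)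

theory Defs
  imports "HOL-Analysis.Analysis"
begin

text \<open>
  A normed space over \<open>K\<close>, where \<open>K\<close> is the real or the complex field, realised as a subset of
  the type \<^typ>\<open>complex\<close>. The underlying set of the space is the whole type \<open>'a\<close>; addition, norm
  and real scaling come from the class \<^class>\<open>real_normed_vector\<close>, and \<open>sc\<close> is the multiplication
  by scalars in \<open>K\<close>, extending real scaling. For \<open>K = \<real>\<close> this is just a real normed space, and
  the values of \<open>sc\<close> at non-real scalars play no role.
\<close>

locale normed_space_over =
  fixes K :: "complex set"
    and sc :: "complex \<Rightarrow> 'a::real_normed_vector \<Rightarrow> 'a"
  assumes scalars: "K = \<real> \<or> K = UNIV"
    and sc_of_real: "sc (of_real r) x = r *\<^sub>R x"
    and sc_add_left: "a \<in> K \<Longrightarrow> b \<in> K \<Longrightarrow> sc (a + b) x = sc a x + sc b x"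
    and sc_add_right: "a \<in> K \<Longrightarrow> sc a (x + y) = sc a x + sc a y"
    and sc_sc: "a \<in> K \<Longrightarrow> b \<in> K \<Longrightarrow> sc a (sc b x) = sc (a * b) x"
    and norm_sc: "a \<in> K \<Longrightarrow> norm (sc a x) = cmod a * norm x"

definition linear_subspace ::
  "complex set \<Rightarrow> (complex \<Rightarrow> 'a::real_normed_vector \<Rightarrow> 'a) \<Rightarrow> 'a set \<Rightarrow> bool" where
  "linear_subspace K sc D \<longleftrightarrow>
     0 \<in> D \<and> (\<forall>x\<in>D. \<forall>y\<in>D. x + y \<in> D) \<and> (\<forall>a\<in>K. \<forall>x\<in>D. sc a x \<in> D)"

text \<open>
  An operator \<open>T : D(T) \<subseteq> X \<rightarrow> X\<close> is given by its domain \<open>D\<close> and a function \<open>T\<close> on the whole type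
  whose values outside \<open>D\<close> are irrelevant.
\<close>

definition linear_operator ::
  "complex set \<Rightarrow> (complex \<Rightarrow> 'a::real_normed_vector \<Rightarrow> 'a) \<Rightarrow> 'a set \<Rightarrow> ('a \<Rightarrow> 'a) \<Rightarrow> bool" where
  "linear_operator K sc D T \<longleftrightarrow> linear_subspace K sc D \<and>
     (\<forall>x\<in>D. \<forall>y\<in>D. T (x + y) = T x + T y) \<and> (\<forall>a\<in>K. \<forall>x\<in>D. T (sc a x) = sc a (T x))"

primrec dom_power :: "'a set \<Rightarrow> ('a \<Rightarrow> 'a) \<Rightarrow> nat \<Rightarrow> 'a set" where
  "dom_power D T 0 = UNIV"
| "dom_power D T (Suc n) = {x \<in> D. T x \<in> dom_power D T n}"

definition dom_infinity :: "'a set \<Rightarrow> ('a \<Rightarrow> 'a) \<Rightarrow> 'a set" where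
  "dom_infinity D T = (\<Inter>n. dom_power D T n)"

definition bounded_operators ::
  "complex set \<Rightarrow> (complex \<Rightarrow> 'a::real_normed_vector \<Rightarrow> 'a) \<Rightarrow> ('a \<Rightarrow> 'a) set" where
  "bounded_operators K sc =
     {A. bounded_linear A \<and> (\<forall>a\<in>K. \<forall>x. A (sc a x) = sc a (A x))}"

definition banach_space :: "'a::real_normed_vector itself \<Rightarrow> bool" where
  "banach_space _ \<longleftrightarrow> complete (UNIV :: 'a set)"

text \<open>
  The given norm is complete and is induced by a complex inner product \<open>ip\<close>, linear in the first
  argument. Positive definiteness of \<open>ip\<close> is contained in the last condition.
\<close>

definition complex_hilbert_space ::
  "complex set \<Rightarrow> (complex \<Rightarrow> 'a::real_normed_vector \<Rightarrow> 'a) \<Rightarrow> bool" where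
  "complex_hilbert_space K sc \<longleftrightarrow> K = UNIV \<and> banach_space TYPE('a) \<and>
     (\<exists>ip :: 'a \<Rightarrow> 'a \<Rightarrow> complex.
        (\<forall>x y z. ip (x + y) z = ip x z + ip y z) \<and>
        (\<forall>a x y. ip (sc a x) y = a * ip x y) \<and>
        (\<forall>x y. ip y x = cnj (ip x y)) \<and>
        (\<forall>x. ip x x = of_real ((norm x)\<^sup>2)))"

text \<open>
  The series of reciprocals are taken in \<^typ>\<open>ennreal\<close>, where \<open>1 / 0 = \<infinity>\<close>; in \<^typ>\<open>real\<close>, where
  \<open>1 / 0 = 0\<close>, a vanishing \<open>\<parallel>T\<^sup>k C\<parallel>\<close> would wrongly contribute nothing. The index is shifted so
  that the sums start at \<open>T\<^sup>1 C\<close>.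
\<close>

definition banach_condition :: "('a::real_normed_vector \<Rightarrow> 'a) \<Rightarrow> ('a \<Rightarrow> 'a) \<Rightarrow> bool" where
  "banach_condition T C \<longleftrightarrow> banach_space TYPE('a) \<and>
     (\<Sum>k. 1 / ennreal (onorm ((T ^^ Suc k) \<circ> C))) < \<infinity>"

definition hilbert_condition ::
  "complex set \<Rightarrow> (complex \<Rightarrow> 'a::real_normed_vector \<Rightarrow> 'a) \<Rightarrow> ('a \<Rightarrow> 'a) \<Rightarrow> ('a \<Rightarrow> 'a) \<Rightarrow> bool" where
  "hilbert_condition K sc T C \<longleftrightarrow> complex_hilbert_space K sc \<and>
     (\<Sum>k. 1 / (ennreal (onorm ((T ^^ Suc k) \<circ> C)))\<^sup>2) < \<infinity>"

end

theory Submission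
  imports Defs "HOL-Complex_Analysis.Conformal_Mappings"
begin

text \<open>
  Write \<open>S\<^sub>k = T\<^sup>k\<^sup>+\<^sup>1 C\<close>. These are bounded linear operators for which \<open>1 / \<parallel>S\<^sub>k\<parallel>\<close>,
  respectively \<open>1 / \<parallel>S\<^sub>k\<parallel>\<^sup>2\<close>, is summable. A summable
  positive series can be enlarged, termwise by factors tending to infinity, without losing
  summability (\<open>summable_enlarge\<close>). So it suffices to find one vector \<open>z\<close> with
  \<open>\<parallel>S\<^sub>k z\<parallel> \<ge> c w\<^sub>k \<parallel>S\<^sub>k\<parallel>\<close> for all \<open>k\<close>, where \<open>c > 0\<close> is a constant and \<open>w\<close> is any given
  positive sequence of small sum, respectively of small sum of squares. This is a plank theorem:
  choose \<open>x\<^sub>k\<close> in the unit ball that almost norms \<open>S\<^sub>k\<close> and a functional of norm one that norms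
  \<open>S\<^sub>k x\<^sub>k\<close>; then \<open>z\<close> has to avoid the planks given by the composed functionals.

  In a Banach space, look for \<open>z = \<Sum>\<^sub>j \<surd>w\<^sub>j y\<^sub>j x\<^sub>j\<close> with \<open>\<Sum>\<^sub>j y\<^sub>j\<^sup>2 \<le> 1\<close>. With finitely many
  operators this is a statement on a real matrix \<open>A\<close> with unit diagonal (\<open>plank_matrix\<close>). If the
  columns of \<open>A\<close> are rescaled by \<open>\<surd>w\<^sub>j\<close> to give \<open>B\<close>, one would like to turn \<open>B\<close> by an orthogonal
  matrix \<open>U\<close> and rescale its rows so that it becomes symmetric, because for a symmetric matrix signs
  chosen to maximise the quadratic form do the job (Bang's argument, \<open>bang_signs\<close>). A suitable
  \<open>U\<close> is a minimiser of \<open>\<Sum>\<^sub>i (w\<^sub>i / (BU)\<^sub>i\<^sub>i)\<^sup>2\<close>: stationarity under plane rotations is exactly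
  the symmetry, and comparison with \<open>U = 1\<close> shows that the minimum is at most \<open>\<Sum>\<^sub>i w\<^sub>i\<close>, which
  is the bound on \<open>\<Sum>\<^sub>j y\<^sub>j\<^sup>2\<close> (\<open>exists_balanced_frame\<close>). The factors \<open>\<surd>w\<^sub>j\<close> make the
  finite solutions uniformly small in their tails, so a subsequence of them converges in norm
  (\<open>plank_operators\<close>).

  In a complex Hilbert space, the functionals \<open>\<phi>\<^sub>k\<close> have to satisfy \<open>\<bar>\<phi>\<^sub>k z\<bar> \<ge> c t\<^sub>k\<close> where
  only \<open>\<Sum>\<^sub>k t\<^sub>k\<^sup>2\<close> is small. For finitely many of them take a unit vector \<open>z\<close> that almost
  maximises \<open>\<Prod>\<^sub>k \<bar>\<phi>\<^sub>k z\<bar> ^ m\<^sub>k\<close>, with integers \<open>m\<^sub>k\<close> roughly proportional to \<open>t\<^sub>k\<^sup>2\<close>. On a complex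
  line through \<open>z\<close> orthogonal to \<open>z\<close> the norm grows only quadratically, so the product cannot
  grow much on a disc of radius of order \<open>t\<^sub>k\<close>; by the maximum modulus principle \<open>\<phi>\<^sub>k\<close> cannot
  have a zero close to the centre of the disc, and this bounds \<open>\<bar>\<phi>\<^sub>k z\<bar>\<close> from below
  (\<open>plank_functionals_finite\<close>). The passage to infinitely many functionals is weak compactness of the
  unit ball, in the form of an intersection of nested convex sets
  (\<open>nested_midconvex_nonempty\<close>).
\<close>

section \<open>Enlarging series and extracting subsequences\<close>

text \<open>
  Dividing \<open>a\<^sub>k\<close> by the square root of the tail \<open>R\<^sub>k = \<Sum>\<^sub>j\<^sub>\<ge>\<^sub>k a\<^sub>j\<close> preserves summability,
  because \<open>a\<^sub>k / \<surd>R\<^sub>k \<le> 2 (\<surd>R\<^sub>k - \<surd>R\<^sub>k\<^sub>+\<^sub>1)\<close> is dominated by a telescoping series.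
\<close>

lemma summable_enlarge:
  fixes a :: "nat \<Rightarrow> real"
  assumes pos: "\<And>k. a k > 0" and sa: "summable a"
  obtains w :: "nat \<Rightarrow> real" where "\<And>k. w k > 0" "summable w" "suminf w \<le> 1/2"
    "filterlim (\<lambda>k. w k / a k) at_top sequentially"
proof -
  define R where "R k = (\<Sum>j. a (j + k))" for k
  have sak: "summable (\<lambda>j. a (j + k))" for k
    using sa by (simp add: summable_iff_shift)
  have Rpos: "R k > 0" for k
    unfolding R_def using sak pos by (intro suminf_pos)
  have Rrec: "R k = a k + R (Suc k)" for k
    using suminf_split_head[OF sak[of k]] by (simp add: R_def)
  have R0: "R \<longlonglongrightarrow> 0"
    unfolding R_def using suminf_exist_split2[OF sa] by simp
  define s where "s k = sqrt (R k)" for k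
  have spos: "s k > 0" for k using Rpos by (simp add: s_def)
  have s0: "s \<longlonglongrightarrow> 0" unfolding s_def using tendsto_real_sqrt[OF R0] by simp
  have tel: "(\<lambda>k. 2 * (s k - s (Suc k))) sums (2 * (s 0 - 0))"
    by (intro sums_mult telescope_sums' s0)
  have le: "a k / s k \<le> 2 * (s k - s (Suc k))" for k
  proof -
    have "a k = (s k)\<^sup>2 - (s (Suc k))\<^sup>2"
      using Rrec[of k] Rpos[of k] Rpos[of "Suc k"] by (simp add: s_def)
    also have "\<dots> = (s k - s (Suc k)) * (s k + s (Suc k))"
      by (simp add: power2_eq_square algebra_simps)
    also have "\<dots> \<le> (s k - s (Suc k)) * (2 * s k)"
    proof (rule mult_left_mono)
      have "s (Suc k) \<le> s k" using Rrec[of k] pos[of k] by (simp add: s_def)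
      then show "s k + s (Suc k) \<le> 2 * s k" "0 \<le> s k - s (Suc k)" by simp_all
    qed
    finally show ?thesis using spos[of k] by (simp add: field_simps)
  qed
  have nn: "0 \<le> a k / s k" for k using pos[of k] spos[of k] by simp
  have sb: "summable (\<lambda>k. a k / s k)"
  proof (rule summable_comparison_test'[OF sums_summable[OF tel], of 0])
    show "norm (a k / s k) \<le> 2 * (s k - s (Suc k))" for k
      using le[of k] nn[of k] by (metis abs_of_nonneg real_norm_def)
  qed
  have lb: "(\<Sum>k. a k / s k) \<le> 2 * s 0"
    using suminf_le[OF le sb sums_summable[OF tel]] sums_unique[OF tel] by simp
  define w where "w k = a k / s k * (1 / (4 * s 0))" for k
  show thesis
  proof
    show "w k > 0" for k using pos[of k] spos[of k] spos[of 0] by (simp add: w_def)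
    show "summable w" unfolding w_def by (intro summable_mult2 sb)
    have "suminf w = (\<Sum>k. a k / s k) * (1 / (4 * s 0))"
      unfolding w_def by (rule suminf_mult2[OF sb, symmetric])
    then have "suminf w * (4 * s 0) \<le> 1/2 * (4 * s 0)" using lb spos[of 0] by simp
    then show "suminf w \<le> 1/2" using spos[of 0] by (simp only: mult_le_cancel_right_pos)
    have "filterlim (\<lambda>k. inverse (s k)) at_top sequentially"
      using s0 spos by (intro filterlim_inverse_at_top) auto
    then have "filterlim (\<lambda>k. (1 / (4 * s 0)) * inverse (s k)) at_top sequentially"
      using spos[of 0] by (intro filterlim_tendsto_pos_mult_at_top[OF tendsto_const]) auto
    moreover have "w k / a k = (1 / (4 * s 0)) * inverse (s k)" for k
      using pos[of k] spos[of k] spos[of 0] by (simp add: w_def field_simps)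
    ultimately show "filterlim (\<lambda>k. w k / a k) at_top sequentially" by simp
  qed
qed

lemma compact_PiE_UNIV:
  fixes K :: "'i \<Rightarrow> 'b::topological_space set"
  assumes "\<And>i. compact (K i)"
  shows "compact (PiE UNIV K)"
proof -
  have "compactin (product_topology (\<lambda>i. euclidean) UNIV) (PiE UNIV K)"
    using assms by (subst compactin_PiE) auto
  then show ?thesis by (simp add: euclidean_product_topology)
qed

text \<open>
  By Tychonoff the sequences with values in given compact sets form a compact set, and the product
  topology on \<^typ>\<open>nat \<Rightarrow> 'b\<close> is metrisable, so that compactness yields subsequences.
\<close>

lemma pointwise_convergent_subsequence:
  fixes f :: "nat \<Rightarrow> nat \<Rightarrow> 'b::heine_borel"
  assumes "\<And>k. bounded (range (\<lambda>n. f n k))"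
  obtains r l where "strict_mono (r :: nat \<Rightarrow> nat)" "\<And>k. (\<lambda>n. f (r n) k) \<longlonglongrightarrow> l k"
proof -
  let ?K = "PiE UNIV (\<lambda>k. closure (range (\<lambda>n. f n k)))"
  have "compact ?K"
    using assms by (intro compact_PiE_UNIV) (simp add: compact_closure)
  moreover have "f n \<in> ?K" for n
    using closure_subset by (fastforce simp: PiE_def)
  ultimately obtain l r where r: "strict_mono (r :: nat \<Rightarrow> nat)" and l: "(f \<circ> r) \<longlonglongrightarrow> l"
    unfolding compact_eq_seq_compact_metric seq_compact_def by blast
  have "(\<lambda>n. f (r n) k) \<longlonglongrightarrow> l k" for k
  proof -
    have "isCont (\<lambda>g. g k) l"
      by (metis continuous_on_eq_continuous_at continuous_on_product_coordinates open_UNIV UNIV_I)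
    from isCont_tendsto_compose[OF this l] show ?thesis by (simp add: o_def)
  qed
  with r that show thesis by blast
qed

section \<open>Bang's sign lemma\<close>

text \<open>
  Take the signs that maximise the quadratic form \<open>\<Sum>\<^sub>i\<^sub>j N\<^sub>i\<^sub>j e\<^sub>i e\<^sub>j\<close>. By symmetry, flipping
  \<open>e\<^sub>k\<close> changes it by \<open>- 4 e\<^sub>k \<Sum>\<^sub>j\<^sub>\<noteq>\<^sub>k N\<^sub>k\<^sub>j e\<^sub>j\<close>, so this off-diagonal sum has the sign of
  \<open>e\<^sub>k\<close> and adds to the diagonal term instead of cancelling it.
\<close>

lemma bang_signs:
  fixes N :: "'i \<Rightarrow> 'i \<Rightarrow> real"
  assumes fin: "finite I" and sym: "\<And>i j. i \<in> I \<Longrightarrow> j \<in> I \<Longrightarrow> N i j = N j i"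
  obtains e :: "'i \<Rightarrow> real" where "\<And>i. i \<in> I \<Longrightarrow> e i = 1 \<or> e i = -1"
    "\<And>i. i \<in> I \<Longrightarrow> N i i \<le> e i * (\<Sum>j\<in>I. N i j * e j)"
proof -
  let ?E = "PiE I (\<lambda>_. {1, -1 :: real})"
  define Q where "Q e = (\<Sum>i\<in>I. \<Sum>j\<in>I. N i j * e i * e j)" for e
  have finE: "finite ?E" using fin by (intro finite_PiE) auto
  have neE: "?E \<noteq> {}" by (simp add: PiE_eq_empty_iff)
  obtain e where e: "e \<in> ?E" and max: "\<And>e'. e' \<in> ?E \<Longrightarrow> Q e' \<le> Q e"
  proof -
    have "Max (Q ` ?E) \<in> Q ` ?E" using finE neE by (intro Max_in) auto
    then obtain e where "e \<in> ?E" "Max (Q ` ?E) = Q e" by blast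
    with that[of e] finE show thesis by (metis Max_ge finite_imageI image_eqI)
  qed
  have val: "e i = 1 \<or> e i = -1" if "i \<in> I" for i using e that by (auto simp: PiE_iff)
  have "N k k \<le> e k * (\<Sum>j\<in>I. N k j * e j)" if k: "k \<in> I" for k
  proof -
    let ?J = "I - {k}"
    define S where "S = (\<Sum>j\<in>?J. N k j * e j)"
    define Z where "Z = (\<Sum>i\<in>?J. \<Sum>j\<in>?J. N i j * e i * e j)"
    have expand: "Q (e(k := t)) = N k k * t * t + 2 * t * S + Z" for t
    proof -
      have "Q (e(k := t)) = (\<Sum>j\<in>I. N k j * t * (e(k := t)) j) +
          (\<Sum>i\<in>?J. \<Sum>j\<in>I. N i j * e i * (e(k := t)) j)"
        unfolding Q_def by (subst sum.remove[OF fin k]) (auto intro!: sum.cong)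
      also have "(\<Sum>j\<in>I. N k j * t * (e(k := t)) j) = N k k * t * t + t * S"
        unfolding S_def by (subst sum.remove[OF fin k]) (auto simp: sum_distrib_left intro!: sum.cong)
      also have "(\<Sum>i\<in>?J. \<Sum>j\<in>I. N i j * e i * (e(k := t)) j) =
          (\<Sum>i\<in>?J. t * (N k i * e i) + (\<Sum>j\<in>?J. N i j * e i * e j))"
        by (rule sum.cong) (auto simp: sum.remove[OF fin k] sym[OF _ k] intro!: sum.cong)
      also have "\<dots> = t * S + Z" by (simp add: sum.distrib S_def Z_def sum_distrib_left)
      finally show ?thesis by (simp only: algebra_simps)
    qed
    have "e(k := - e k) \<in> ?E" using e k val[OF k] by (auto simp: PiE_iff extensional_def)
    from max[OF this] have "Q (e(k := - e k)) \<le> Q (e(k := e k))" by simp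
    then have "0 \<le> e k * S" unfolding expand by (simp add: mult.commute)
    moreover have "e k * (\<Sum>j\<in>I. N k j * e j) = N k k * (e k * e k) + e k * S"
      unfolding S_def by (subst sum.remove[OF fin k]) (simp add: algebra_simps)
    moreover have "e k * e k = 1" using val[OF k] by auto
    ultimately show ?thesis by simp
  qed
  with val that show thesis by blast
qed

section \<open>Frames that symmetrise a matrix\<close>

text \<open>
  The vectors \<open>u (0, \<cdot>), \<dots>, u (n - 1, \<cdot>)\<close> are an orthonormal basis of \<open>\<real>\<^sup>n\<close>. A frame is one
  function on pairs of indices because such functions carry a metrisable product topology for every
  \<open>n\<close> at once; the values outside the \<open>n \<times> n\<close> square are fixed to keep the set of frames compact.
\<close>

definition orthonormal_frame :: "nat \<Rightarrow> (nat \<times> nat \<Rightarrow> real) \<Rightarrow> bool" where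
  "orthonormal_frame n u \<longleftrightarrow>
     (\<forall>a<n. \<forall>b<n. (\<Sum>k<n. u (a, k) * u (b, k)) = (if a = b then 1 else 0)) \<and>
     (\<forall>a k. \<not> (a < n \<and> k < n) \<longrightarrow> u (a, k) = 0)"

lemma compact_orthonormal_frames: "compact {u. orthonormal_frame n u}"
proof -
  have bound: "\<bar>u (a, k)\<bar> \<le> 1" if u: "orthonormal_frame n u" for u a k
  proof (cases "a < n \<and> k < n")
    case True
    have "(u (a, k))\<^sup>2 \<le> (\<Sum>k<n. (u (a, k))\<^sup>2)"
      using True by (intro member_le_sum) auto
    also have "\<dots> = 1" using u True by (simp add: orthonormal_frame_def power2_eq_square)
    finally show ?thesis by (simp add: abs_square_le_1)
  qed (use u in \<open>auto simp: orthonormal_frame_def\<close>)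
  have "closed {u. orthonormal_frame n u}"
    unfolding orthonormal_frame_def
    by (intro closed_Collect_conj closed_Collect_all closed_Collect_imp open_Collect_const
        closed_Collect_eq continuous_intros continuous_on_product_coordinates)
  moreover have "{u. orthonormal_frame n u} \<subseteq> PiE UNIV (\<lambda>_. {-1..1})"
  proof
    fix u assume "u \<in> {u. orthonormal_frame n u}"
    then have "\<bar>u p\<bar> \<le> 1" for p using bound[of u "fst p" "snd p"] by simp
    then show "u \<in> PiE UNIV (\<lambda>_. {-1..1})" by (auto simp: abs_le_iff minus_le_iff)
  qed
  moreover have "compact (PiE (UNIV :: (nat \<times> nat) set) (\<lambda>_. {-1..1 :: real}))"
    by (intro compact_PiE_UNIV compact_Icc)
  ultimately show ?thesis
    by (metis closed_Int_compact inf.absorb1 inf.commute)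
qed

definition rotate_frame :: "nat \<Rightarrow> nat \<Rightarrow> real \<Rightarrow> (nat \<times> nat \<Rightarrow> real) \<Rightarrow> nat \<times> nat \<Rightarrow> real" where
  "rotate_frame i j t u = (\<lambda>(a, k).
     if a = i then cos t * u (i, k) + sin t * u (j, k)
     else if a = j then cos t * u (j, k) - sin t * u (i, k)
     else u (a, k))"

lemma orthonormal_rotate_frame:
  assumes u: "orthonormal_frame n u" and ij: "i < n" "j < n" "i \<noteq> j"
  shows "orthonormal_frame n (rotate_frame i j t u)"
proof -
  define p where "p a b = (\<Sum>k<n. u (a, k) * u (b, k))" for a b
  have p: "p a b = (if a = b then 1 else 0)" if "a < n" "b < n" for a b
    using u that by (simp add: p_def orthonormal_frame_def)
  have lin: "(\<Sum>k<n. (x * u (a, k) + y * u (b, k)) * (x' * u (c, k) + y' * u (d, k))) =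
      x * x' * p a c + x * y' * p a d + y * x' * p b c + y * y' * p b d" for x y x' y' a b c d
    by (simp add: p_def sum_distrib_left algebra_simps flip: sum.distrib)
  \<comment> \<open>Every row of the rotated frame is a combination of row \<open>a\<close> and a single other row \<open>m a\<close>.\<close>
  define x where "x a = (if a = i \<or> a = j then cos t else 1)" for a
  define y where "y a = (if a = i then sin t else if a = j then - sin t else 0)" for a
  define m where "m a = (if a = i then j else i)" for a
  have rot: "rotate_frame i j t u (a, k) = x a * u (a, k) + y a * u (m a, k)" for a k
    using ij by (auto simp: rotate_frame_def x_def y_def m_def)
  have cs: "cos t * cos t + sin t * sin t = 1"
    using sin_cos_squared_add[of t] by (simp add: power2_eq_square)
  show ?thesis
    unfolding orthonormal_frame_def
  proof (intro conjI allI impI)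
    fix a b assume ab: "a < n" "b < n"
    have "m a < n" "m b < n" using ij by (auto simp: m_def)
    then show "(\<Sum>k<n. rotate_frame i j t u (a, k) * rotate_frame i j t u (b, k)) =
        (if a = b then 1 else 0)"
      unfolding rot lin using ab ij cs
      by (simp add: p) (auto simp: x_def y_def m_def algebra_simps)
  next
    fix a k assume "\<not> (a < n \<and> k < n)"
    then show "rotate_frame i j t u (a, k) = 0"
      using u ij by (auto simp: rotate_frame_def orthonormal_frame_def)
  qed
qed

text \<open>
  Here \<open>c u i j\<close> is the entry \<open>(BU)\<^sub>i\<^sub>j\<close>, where \<open>U\<close> is the orthogonal matrix whose columns are the
  vectors of the frame. The frame minimises \<open>F u = \<Sum>\<^sub>i (w\<^sub>i / c u i i)\<^sup>2\<close> on a compact set. The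
  standard frame gives \<open>F = \<Sum>\<^sub>i w\<^sub>i \<le> 1\<close>, which forces \<open>c u i i \<ge> w\<^sub>i\<close> at the minimum. Hence the
  constraint \<open>c u i i \<ge> w\<^sub>i / 2\<close>, which keeps \<open>F\<close> continuous, is not active there, and \<open>F\<close> is
  stationary under all rotations. The rotation in the plane of the \<open>i\<close>-th and \<open>j\<close>-th vectors changes
  only two summands of \<open>F\<close>, and the vanishing of its derivative is the symmetry in the last line.
\<close>

lemma exists_balanced_frame:
  fixes B :: "nat \<Rightarrow> nat \<Rightarrow> real" and w :: "nat \<Rightarrow> real"
  assumes w: "\<And>i. i < n \<Longrightarrow> w i > 0" and w1: "(\<Sum>i<n. w i) \<le> 1"
    and diag: "\<And>i. i < n \<Longrightarrow> B i i = sqrt (w i)"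
  defines "c \<equiv> \<lambda>u i j. \<Sum>k<n. B i k * u (j, k)"
  obtains u where "orthonormal_frame n u" "\<And>i. i < n \<Longrightarrow> c u i i > 0"
    "(\<Sum>i<n. (w i / c u i i)\<^sup>2) \<le> 1"
    "\<And>i j. i < n \<Longrightarrow> j < n \<Longrightarrow>
       (w i)\<^sup>2 / c u i i ^ 3 * c u i j = (w j)\<^sup>2 / c u j j ^ 3 * c u j i"
proof -
  define F where "F u = (\<Sum>i<n. (w i / c u i i)\<^sup>2)" for u
  define G where "G = {u. orthonormal_frame n u} \<inter> {u. \<forall>i<n. w i / 2 \<le> c u i i}"
  have contc: "continuous_on A (\<lambda>u. c u i j)" for A i j
    unfolding c_def
    by (rule continuous_on_subset[OF _ subset_UNIV])
       (intro continuous_intros continuous_on_product_coordinates)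
  have "closed {u. \<forall>i<n. w i / 2 \<le> c u i i}"
    by (intro closed_Collect_all closed_Collect_imp open_Collect_const closed_Collect_le
        continuous_on_const contc)
  then have compG: "compact G"
    unfolding G_def by (intro compact_Int_closed compact_orthonormal_frames)
  \<comment> \<open>The standard frame is the competitor that bounds the minimum by \<open>\<Sum>\<^sub>i w\<^sub>i\<close>.\<close>
  define I where "I = (\<lambda>(a, k). if a = k \<and> a < n then 1 else 0 :: real)"
  have cI: "c I i i = sqrt (w i)" if "i < n" for i
  proof -
    have "c I i i = (\<Sum>k<n. if k = i then B i k else 0)"
      unfolding c_def by (rule sum.cong) (use that in \<open>auto simp: I_def\<close>)
    then show ?thesis using that diag by simp
  qed
  have wle: "w i \<le> 1" if "i < n" for i
    using member_le_sum[of i "{..<n}" w] w w1 that by (force simp: less_imp_le)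
  have "w i / 2 \<le> sqrt (w i)" if "i < n" for i
    using w[OF that] wle[OF that] by (intro real_le_rsqrt) (auto simp: power2_eq_square mult_le_one)
  moreover have "orthonormal_frame n I"
    unfolding orthonormal_frame_def
    by (auto simp: I_def if_distrib[of "\<lambda>x. x * _"] cong: if_cong)
  ultimately have IG: "I \<in> G" by (auto simp: G_def cI)
  have FI: "F I \<le> 1"
  proof -
    have "F I = (\<Sum>i<n. w i)"
      unfolding F_def
      by (rule sum.cong) (use w in \<open>auto simp: cI power_divide less_imp_le power2_eq_square\<close>)
    then show ?thesis using w1 by simp
  qed
  have "continuous_on G F"
    unfolding F_def
    by (intro continuous_intros contc) (use w in \<open>force simp: G_def\<close>)
  then obtain u where uG: "u \<in> G" and min: "\<And>v. v \<in> G \<Longrightarrow> F u \<le> F v"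
    using continuous_attains_inf[OF compG] IG by blast
  have u: "orthonormal_frame n u" using uG by (simp add: G_def)
  have Fu: "F u \<le> 1" using min[OF IG] FI by simp
  have cpos: "c u i i > 0" if "i < n" for i using uG w[OF that] that by (force simp: G_def)
  have cw: "w i \<le> c u i i" if "i < n" for i
  proof -
    have "(w i / c u i i)\<^sup>2 \<le> F u"
      unfolding F_def by (rule member_le_sum) (use that in auto)
    with Fu have "(w i / c u i i)\<^sup>2 \<le> 1" by simp
    then have "w i / c u i i \<le> 1" by (metis abs_square_le_1 abs_le_D1)
    then show ?thesis using cpos[OF that] by simp
  qed
  have stat: "(w i)\<^sup>2 / c u i i ^ 3 * c u i j = (w j)\<^sup>2 / c u j j ^ 3 * c u j i"
    if ij: "i < n" "j < n" for i j
  proof (cases "i = j")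
    case False
    let ?r = "\<lambda>t. rotate_frame i j t u"
    define g where "g t = cos t * c u i i + sin t * c u i j" for t
    define h where "h t = cos t * c u j j - sin t * c u j i" for t
    have ci: "c (?r t) i i = g t" for t
      unfolding c_def g_def
      by (simp add: rotate_frame_def algebra_simps sum_distrib_left flip: sum.distrib)
    have cj: "c (?r t) j j = h t" for t
      using False unfolding c_def h_def
      by (simp add: rotate_frame_def algebra_simps sum_distrib_left flip: sum_subtractf)
    have ck: "c (?r t) k k = c u k k" if "k \<noteq> i" "k \<noteq> j" for t k
      using that unfolding c_def by (simp add: rotate_frame_def)
    define R where "R = (\<Sum>k\<in>{..<n}-{i}-{j}. (w k / c u k k)\<^sup>2)"
    have Fr: "F (?r t) = (w i / g t)\<^sup>2 + (w j / h t)\<^sup>2 + R" for t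
    proof -
      have "F (?r t) = (w i / c (?r t) i i)\<^sup>2 + ((w j / c (?r t) j j)\<^sup>2 +
          (\<Sum>k\<in>{..<n}-{i}-{j}. (w k / c (?r t) k k)\<^sup>2))"
        unfolding F_def using ij False
        by (subst sum.remove[of _ i], simp, simp, subst sum.remove[of _ j]) auto
      also have "(\<Sum>k\<in>{..<n}-{i}-{j}. (w k / c (?r t) k k)\<^sup>2) = R"
        unfolding R_def by (rule sum.cong) (auto simp: ck)
      finally show ?thesis by (simp add: ci cj)
    qed
    have g0: "g 0 = c u i i" "h 0 = c u j j" by (simp_all add: g_def h_def)
    have "eventually (\<lambda>t. w i / 2 < g t) (at 0)" "eventually (\<lambda>t. w j / 2 < h t) (at 0)"
    proof -
      have "isCont g 0" "isCont h 0" unfolding g_def h_def by (intro continuous_intros)+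
      then have "(g \<longlongrightarrow> c u i i) (at 0)" "(h \<longlongrightarrow> c u j j) (at 0)"
        unfolding isCont_def g0 by auto
      moreover have "w i / 2 < c u i i" "w j / 2 < c u j j"
        using cw[of i] cw[of j] w[of i] w[of j] ij by auto
      ultimately show "eventually (\<lambda>t. w i / 2 < g t) (at 0)" "eventually (\<lambda>t. w j / 2 < h t) (at 0)"
        by (blast intro: order_tendstoD(1))+
    qed
    then have "eventually (\<lambda>t. F (?r 0) \<le> F (?r t)) (at 0)"
    proof eventually_elim
      case (elim t)
      have "?r t \<in> G"
        using uG elim ij False orthonormal_rotate_frame[OF u ij False]
        by (auto simp: G_def) (metis ci cj ck less_imp_le)
      moreover have "?r 0 = u" by (auto simp: rotate_frame_def)
      ultimately show ?case using min by simp
    qed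
    then obtain d where d: "d > 0" "\<And>t. t \<noteq> 0 \<Longrightarrow> dist t 0 < d \<Longrightarrow> F (?r 0) \<le> F (?r t)"
      unfolding eventually_at by auto
    have c0: "c u i i \<noteq> 0" "c u j j \<noteq> 0" using cpos ij by (auto simp: less_imp_neq[symmetric])
    have "((\<lambda>t. F (?r t)) has_real_derivative
        2 * ((w j)\<^sup>2 / c u j j ^ 3 * c u j i - (w i)\<^sup>2 / c u i i ^ 3 * c u i j)) (at 0)"
      unfolding Fr g_def h_def using c0
      by (auto intro!: derivative_eq_intros simp: field_simps power2_eq_square power3_eq_cube)
    then have "2 * ((w j)\<^sup>2 / c u j j ^ 3 * c u j i - (w i)\<^sup>2 / c u i i ^ 3 * c u i j) = 0"
    proof (rule DERIV_local_min[OF _ d(1)])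
      show "\<forall>t. \<bar>0 - t\<bar> < d \<longrightarrow> F (?r 0) \<le> F (?r t)"
        using d(2) by (metis diff_0 dist_real_def abs_minus_cancel diff_zero order_refl)
    qed
    then show ?thesis by simp
  qed simp
  show thesis
    by (rule that[OF u cpos _ stat]) (use Fu in \<open>auto simp: F_def\<close>)
qed

text \<open>
  The matrix \<open>N\<^sub>i\<^sub>j = \<theta>\<^sub>i (BU)\<^sub>i\<^sub>j v\<^sub>i v\<^sub>j\<close> with \<open>\<theta>\<^sub>i = w\<^sub>i\<^sup>2 / (BU)\<^sub>i\<^sub>i\<^sup>3\<close> and
  \<open>v\<^sub>i = w\<^sub>i / (BU)\<^sub>i\<^sub>i\<close> is symmetric for a balanced frame. Bang's signs \<open>e\<close> for it give
  \<open>\<bar>(BU(ev))\<^sub>i\<bar> \<ge> (BU)\<^sub>i\<^sub>i v\<^sub>i = w\<^sub>i\<close>, and \<open>y = U(ev)\<close> has the same Euclidean norm as \<open>v\<close>,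
  which is at most one.
\<close>

proposition plank_matrix:
  fixes A :: "nat \<Rightarrow> nat \<Rightarrow> real" and w :: "nat \<Rightarrow> real"
  assumes w: "\<And>i. i < n \<Longrightarrow> w i > 0" and w1: "(\<Sum>i<n. w i) \<le> 1"
    and diag: "\<And>i. i < n \<Longrightarrow> A i i = 1"
  obtains y where "(\<Sum>j<n. (y j)\<^sup>2) \<le> 1"
    "\<And>i. i < n \<Longrightarrow> w i \<le> \<bar>\<Sum>j<n. A i j * (sqrt (w j) * y j)\<bar>"
proof -
  define B where "B i j = A i j * sqrt (w j)" for i j
  define c where "c u i j = (\<Sum>k<n. B i k * u (j, k))" for u :: "nat \<times> nat \<Rightarrow> real" and i j
  obtain u where u: "orthonormal_frame n u" and cpos: "\<And>i. i < n \<Longrightarrow> c u i i > 0"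
    and small: "(\<Sum>i<n. (w i / c u i i)\<^sup>2) \<le> 1"
    and sym: "\<And>i j. i < n \<Longrightarrow> j < n \<Longrightarrow>
       (w i)\<^sup>2 / c u i i ^ 3 * c u i j = (w j)\<^sup>2 / c u j j ^ 3 * c u j i"
    using exists_balanced_frame[of n w B, OF w w1] diag unfolding c_def B_def by auto
  define v where "v i = w i / c u i i" for i
  define N where "N i j = (w i)\<^sup>2 / c u i i ^ 3 * c u i j * (v i * v j)" for i j
  have "N i j = N j i" if "i \<in> {..<n}" "j \<in> {..<n}" for i j
    using sym[of i j] that by (simp add: N_def mult.commute)
  then obtain e where e: "\<And>i. i \<in> {..<n} \<Longrightarrow> e i = 1 \<or> e i = -1"
      and bang: "\<And>i. i \<in> {..<n} \<Longrightarrow> N i i \<le> e i * (\<Sum>j<n. N i j * e j)"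
    using bang_signs[of "{..<n}" N] by blast
  define y where "y k = (\<Sum>j<n. e j * v j * u (j, k))" for k
  show thesis
  proof
    have "(\<Sum>k<n. (y k)\<^sup>2) =
        (\<Sum>k<n. \<Sum>i<n. \<Sum>j<n. (e i * v i) * (e j * v j) * (u (i, k) * u (j, k)))"
      by (simp add: y_def power2_eq_square sum_product algebra_simps)
    also have "\<dots> = (\<Sum>i<n. \<Sum>j<n. (e i * v i) * (e j * v j) * (\<Sum>k<n. u (i, k) * u (j, k)))"
      by (subst sum.swap, rule sum.cong[OF refl], subst sum.swap) (simp add: sum_distrib_left)
    also have "\<dots> = (\<Sum>i<n. \<Sum>j<n. if j = i then (e i * v i) * (e j * v j) else 0)"
      using u by (intro sum.cong) (auto simp: orthonormal_frame_def)
    also have "\<dots> = (\<Sum>i<n. (v i)\<^sup>2)"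
      using e by (intro sum.cong) (force simp: power2_eq_square)+
    finally show "(\<Sum>k<n. (y k)\<^sup>2) \<le> 1" using small by (simp add: v_def)
  next
    fix i assume i: "i < n"
    define Y where "Y = (\<Sum>k<n. A i k * (sqrt (w k) * y k))"
    have "Y = (\<Sum>k<n. \<Sum>j<n. e j * v j * (B i k * u (j, k)))"
      by (simp add: Y_def y_def B_def sum_distrib_left algebra_simps)
    also have "\<dots> = (\<Sum>j<n. e j * v j * c u i j)"
      by (subst sum.swap) (simp add: c_def sum_distrib_left)
    finally have Y: "Y = (\<Sum>j<n. e j * v j * c u i j)" .
    define C where "C = c u i i"
    have C: "C > 0" using cpos[OF i] by (simp add: C_def)
    have wi: "w i > 0" using w[OF i] .
    have "(\<Sum>j<n. N i j * e j) = (w i)\<^sup>2 / C ^ 3 * v i * Y"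
      unfolding Y C_def by (simp add: N_def sum_distrib_left sum_divide_distrib algebra_simps)
    moreover have "N i i = (w i)\<^sup>2 / C ^ 3 * v i * w i"
      using C by (simp add: N_def v_def C_def)
    ultimately have "(w i)\<^sup>2 / C ^ 3 * v i * w i \<le> (w i)\<^sup>2 / C ^ 3 * v i * (e i * Y)"
      using bang[of i] i by (simp add: algebra_simps)
    moreover have "0 < (w i)\<^sup>2 / C ^ 3 * v i"
      using C wi by (simp add: v_def C_def)
    ultimately have "w i \<le> e i * Y" by (metis mult_le_cancel_left_pos)
    also have "\<dots> \<le> \<bar>Y\<bar>" using e[of i] i by auto
    finally show "w i \<le> \<bar>\<Sum>k<n. A i k * (sqrt (w k) * y k)\<bar>" by (simp add: Y_def)
  qed
qed

section \<open>A plank theorem for operators on a Banach space\<close>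

text \<open>
  The Hahn-Banach theorem on the span of finitely many vectors, written in coordinates: \<open>a\<^sub>j\<close> is the
  value at \<open>y\<^sub>j\<close> of a functional of norm at most one that norms \<open>y\<^sub>k\<close>. Coordinates are used since
  the \<open>y\<^sub>j\<close> may be linearly dependent. The induction adds one vector at a time; the new value may
  be any number between the bounds that the old functional imposes on it.
\<close>

lemma norming_coordinates:
  fixes y :: "'i \<Rightarrow> 'a::real_normed_vector"
  assumes "finite S" "k \<notin> S"
  shows "\<exists>a. a k = norm (y k) \<and>
    (\<forall>c. (\<Sum>j\<in>insert k S. c j * a j) \<le> norm (\<Sum>j\<in>insert k S. c j *\<^sub>R y j))"
  using assms
proof (induction S)
  case empty
  show ?case by (intro exI[of _ "\<lambda>_. norm (y k)"]) (auto simp: mult_right_mono)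
next
  case (insert m S)
  then obtain a where ak: "a k = norm (y k)"
    and dom: "\<And>c. (\<Sum>j\<in>insert k S. c j * a j) \<le> norm (\<Sum>j\<in>insert k S. c j *\<^sub>R y j)"
    by auto
  define L where "L c = (\<Sum>j\<in>insert k S. c j * a j)" for c
  define V where "V c = (\<Sum>j\<in>insert k S. c j *\<^sub>R y j)" for c
  have LV: "L c \<le> norm (V c)" for c using dom by (simp add: L_def V_def)
  have L_scale: "L (\<lambda>j. t * c j) = t * L c" for t c
    unfolding L_def sum_distrib_left by (intro sum.cong) (simp_all add: mult.assoc)
  have V_scale: "V (\<lambda>j. t * c j) = t *\<^sub>R V c" for t c
    by (simp add: V_def scaleR_sum_right)
  define \<alpha> where "\<alpha> = (SUP c. L c - norm (V c - y m))"
  have gap: "L c - norm (V c - y m) \<le> norm (V d + y m) - L d" for c d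
  proof -
    have "L c + L d = L (\<lambda>j. c j + d j)"
      unfolding L_def sum.distrib[symmetric] by (intro sum.cong) (simp_all add: algebra_simps)
    also have "\<dots> \<le> norm (V (\<lambda>j. c j + d j))" by (rule LV)
    also have "V (\<lambda>j. c j + d j) = (V c - y m) + (V d + y m)"
      by (simp only: V_def scaleR_add_left sum.distrib) simp
    also have "norm \<dots> \<le> norm (V c - y m) + norm (V d + y m)" by (rule norm_triangle_ineq)
    finally show ?thesis by simp
  qed
  have lower: "L c - norm (V c - y m) \<le> \<alpha>" for c
    unfolding \<alpha>_def by (rule cSUP_upper) (use gap[of _ "\<lambda>_. 0"] in \<open>auto intro!: bdd_aboveI2\<close>)
  have upper: "\<alpha> \<le> norm (V d + y m) - L d" for d
    unfolding \<alpha>_def by (rule cSUP_least) (use gap in auto)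
  \<comment> \<open>Both bounds are at the coefficient \<open>1\<close> of the new vector; scaling gives every \<open>t\<close>.\<close>
  have ext: "L c + t * \<alpha> \<le> norm (V c + t *\<^sub>R y m)" for c t
  proof (rule linorder_cases[of t 0])
    assume t: "t > 0"
    have "t * \<alpha> \<le> t * (norm (V (\<lambda>j. (1/t) * c j) + y m) - L (\<lambda>j. (1/t) * c j))"
      using upper t by (intro mult_left_mono) auto
    also have "\<dots> = norm (t *\<^sub>R (V (\<lambda>j. (1/t) * c j) + y m)) - t * L (\<lambda>j. (1/t) * c j)"
      using t by (simp add: right_diff_distrib)
    finally show ?thesis unfolding L_scale V_scale using t by (simp add: scaleR_add_right)
  next
    assume t: "t < 0"
    have "(-t) * (L (\<lambda>j. (-1/t) * c j) - norm (V (\<lambda>j. (-1/t) * c j) - y m)) \<le> (-t) * \<alpha>"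
      using lower t by (intro mult_left_mono) auto
    moreover have "(-t) * norm (V (\<lambda>j. (-1/t) * c j) - y m)
        = norm ((-t) *\<^sub>R (V (\<lambda>j. (-1/t) * c j) - y m))"
      using t by simp
    ultimately have "(-t) * L (\<lambda>j. (-1/t) * c j)
        - norm ((-t) *\<^sub>R (V (\<lambda>j. (-1/t) * c j) - y m)) \<le> (-t) * \<alpha>"
      by (simp only: right_diff_distrib)
    then show ?thesis unfolding L_scale V_scale using t by (simp add: scaleR_diff_right)
  qed (use LV in auto)
  have km: "k \<noteq> m" and mS: "m \<notin> insert k S" using insert by auto
  have swap: "insert k (insert m S) = insert m (insert k S)" by auto
  have "(\<Sum>j\<in>insert k (insert m S). c j * (a(m := \<alpha>)) j)
      \<le> norm (\<Sum>j\<in>insert k (insert m S). c j *\<^sub>R y j)" for c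
  proof -
    have "(\<Sum>j\<in>insert k S. c j * (a(m := \<alpha>)) j) = L c"
      unfolding L_def by (rule sum.cong) (use mS in auto)
    then show ?thesis
      unfolding swap using ext[of c "c m"] insert.hyps(1) mS
      by (simp only: sum.insert finite_insert fun_upd_same V_def) (simp add: add.commute)
  qed
  then show ?case using ak km by (intro exI[of _ "a(m := \<alpha>)"]) auto
qed

text \<open>
  A norming functional for \<open>T\<^sub>i x\<^sub>i\<close>, divided by \<open>\<parallel>T\<^sub>i x\<^sub>i\<parallel>\<close>, takes at the vectors \<open>T\<^sub>i x\<^sub>j\<close> the
  values in the \<open>i\<close>-th row of a matrix with unit diagonal.
\<close>

lemma plank_operators_finite:
  fixes T :: "nat \<Rightarrow> 'a::real_normed_vector \<Rightarrow> 'b::real_normed_vector"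
  assumes lin: "\<And>i. linear (T i)" and nz: "\<And>i. T i (x i) \<noteq> 0"
    and w: "\<And>i. w i > 0" and w1: "(\<Sum>i<n. w i) \<le> 1"
  obtains y where "(\<Sum>j<n. (y j)\<^sup>2) \<le> 1"
    "\<And>i. i < n \<Longrightarrow> w i * norm (T i (x i)) \<le> norm (T i (\<Sum>j<n. (sqrt (w j) * y j) *\<^sub>R x j))"
proof -
  have "\<exists>a. a i = norm (T i (x i)) \<and>
      (\<forall>c. (\<Sum>j<n. c j * a j) \<le> norm (\<Sum>j<n. c j *\<^sub>R T i (x j)))" if "i < n" for i
  proof -
    have "insert i ({..<n} - {i}) = {..<n}" using that by auto
    then show ?thesis using norming_coordinates[of "{..<n} - {i}" i "\<lambda>j. T i (x j)"] by simp
  qed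
  then obtain a where aii: "\<And>i. i < n \<Longrightarrow> a i i = norm (T i (x i))" and
    dom: "\<And>i c. i < n \<Longrightarrow> (\<Sum>j<n. c j * a i j) \<le> norm (\<Sum>j<n. c j *\<^sub>R T i (x j))"
    by metis
  define A where "A i j = a i j / norm (T i (x i))" for i j
  have A1: "A i i = 1" if "i < n" for i using aii[OF that] nz by (simp add: A_def)
  obtain y where y: "(\<Sum>j<n. (y j)\<^sup>2) \<le> 1"
    and big: "\<And>i. i < n \<Longrightarrow> w i \<le> \<bar>\<Sum>j<n. A i j * (sqrt (w j) * y j)\<bar>"
    using plank_matrix[of n w A, OF w w1 A1] by blast
  show thesis
  proof (rule that[OF y])
    fix i assume i: "i < n"
    define c where "c j = sqrt (w j) * y j" for j
    let ?N = "norm (T i (x i))"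
    have le: "\<bar>\<Sum>j<n. c j * a i j\<bar> \<le> norm (\<Sum>j<n. c j *\<^sub>R T i (x j))"
      using dom[OF i, of c] dom[OF i, of "\<lambda>j. - c j"] by (simp add: sum_negf abs_le_iff)
    have "(\<Sum>j<n. A i j * c j) * ?N = (\<Sum>j<n. c j * a i j)"
      unfolding sum_distrib_right using nz[of i] by (intro sum.cong) (auto simp: A_def)
    then have "\<bar>\<Sum>j<n. A i j * c j\<bar> * ?N = \<bar>\<Sum>j<n. c j * a i j\<bar>"
      by (metis abs_mult abs_norm_cancel)
    moreover have "w i * ?N \<le> \<bar>\<Sum>j<n. A i j * c j\<bar> * ?N"
      using big[OF i] unfolding c_def by (rule mult_right_mono) simp
    ultimately have "w i * ?N \<le> \<bar>\<Sum>j<n. c j * a i j\<bar>" by simp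
    also have "\<dots> \<le> norm (T i (\<Sum>j<n. c j *\<^sub>R x j))"
      using le by (simp add: linear_sum[OF lin] linear_scale[OF lin])
    finally show "w i * ?N \<le> norm (T i (\<Sum>j<n. (sqrt (w j) * y j) *\<^sub>R x j))"
      by (simp add: c_def)
  qed
qed

text \<open>
  The solutions for the first \<open>n\<close> operators are \<open>X n = \<Sum>\<^sub>j \<surd>w\<^sub>j y\<^sub>j x\<^sub>j\<close> with coefficients
  \<open>y = Y n\<close> in the unit ball of \<open>\<ell>\<^sup>2\<close>. By Cauchy-Schwarz the part of \<open>X n\<close> beyond the index \<open>m\<close>
  has norm at most the square root of \<open>\<Sum>\<^sub>j\<^sub>\<ge>\<^sub>m w\<^sub>j\<close>, uniformly in \<open>n\<close>. So along a subsequence for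
  which the coefficients converge one by one, the vectors converge in norm.
\<close>

theorem plank_operators:
  fixes T :: "nat \<Rightarrow> 'a::real_normed_vector \<Rightarrow> 'b::real_normed_vector"
  assumes compl: "complete (UNIV :: 'a set)"
    and T: "\<And>i. bounded_linear (T i)"
    and x: "\<And>i. norm (x i) \<le> 1" and nz: "\<And>i. T i (x i) \<noteq> 0"
    and w: "\<And>i. w i > 0" and sw: "summable w" and w1: "suminf w \<le> 1"
  obtains z where "\<And>i. w i * norm (T i (x i)) \<le> norm (T i z)"
proof -
  have "\<forall>n. \<exists>y. (\<Sum>j<n. (y j)\<^sup>2) \<le> 1 \<and> (\<forall>i<n. w i * norm (T i (x i)) \<le>
      norm (T i (\<Sum>j<n. (sqrt (w j) * y j) *\<^sub>R x j)))"
  proof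
    fix n
    have "(\<Sum>i<n. w i) \<le> suminf w"
      using w by (intro sum_le_suminf[OF sw]) (auto simp: less_imp_le)
    then have "(\<Sum>i<n. w i) \<le> 1" using w1 by linarith
    then obtain y where
      "(\<Sum>j<n. (y j)\<^sup>2) \<le> 1" "\<And>i. i < n \<Longrightarrow> w i * norm (T i (x i)) \<le>
        norm (T i (\<Sum>j<n. (sqrt (w j) * y j) *\<^sub>R x j))"
      using plank_operators_finite[of T x w n] bounded_linear.linear[OF T] nz w by blast
    then show "\<exists>y. (\<Sum>j<n. (y j)\<^sup>2) \<le> 1 \<and> (\<forall>i<n. w i * norm (T i (x i)) \<le>
        norm (T i (\<Sum>j<n. (sqrt (w j) * y j) *\<^sub>R x j)))" by blast
  qed
  then obtain Y0 where Y0': "\<forall>n. (\<Sum>j<n. (Y0 n j)\<^sup>2) \<le> 1 \<and> (\<forall>i<n. w i * norm (T i (x i)) \<le>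
      norm (T i (\<Sum>j<n. (sqrt (w j) * Y0 n j) *\<^sub>R x j)))"
    by (rule exE[OF choice])
  have Y0: "(\<Sum>j<n. (Y0 n j)\<^sup>2) \<le> 1" for n using Y0' by blast
  have big0: "w i * norm (T i (x i)) \<le> norm (T i (\<Sum>j<n. (sqrt (w j) * Y0 n j) *\<^sub>R x j))"
    if "i < n" for i n using Y0' that by blast
  \<comment> \<open>Padding with zeros puts all the coefficient sequences into one space.\<close>
  define Y where "Y n j = (if j < n then Y0 n j else 0)" for n j :: nat
  have Ysum: "(\<Sum>j\<in>J. (Y n j)\<^sup>2) \<le> 1" if "finite J" for J n
  proof -
    have "(\<Sum>j\<in>J. (Y n j)\<^sup>2) = (\<Sum>j\<in>J \<inter> {..<n}. (Y0 n j)\<^sup>2)"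
      using that by (intro sum.mono_neutral_cong_right) (auto simp: Y_def)
    also have "\<dots> \<le> (\<Sum>j<n. (Y0 n j)\<^sup>2)" by (rule sum_mono2) auto
    finally show ?thesis using Y0[of n] by simp
  qed
  define S where "S m n = (\<Sum>j<m. (sqrt (w j) * Y n j) *\<^sub>R x j)" for m n
  define X where "X n = S n n" for n
  have big: "w i * norm (T i (x i)) \<le> norm (T i (X n))" if "i < n" for i n
    using big0[OF that] by (simp add: X_def S_def Y_def)
  define tail where "tail m = (\<Sum>j. w (j + m))" for m
  have tail0: "tail \<longlonglongrightarrow> 0"
    unfolding tail_def using suminf_exist_split2[OF sw] by simp
  have close: "norm (X n - S m n) \<le> sqrt (tail m)" for m n
  proof (cases "m \<le> n")
    case True
    have "X n - S m n = (\<Sum>j=m..<n. (sqrt (w j) * Y n j) *\<^sub>R x j)"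
      unfolding X_def S_def lessThan_atLeast0 using True by (simp add: sum_diff_nat_ivl)
    also have "norm \<dots> \<le> (\<Sum>j=m..<n. \<bar>sqrt (w j)\<bar> * \<bar>Y n j\<bar>)"
      by (rule sum_norm_le) (use x in \<open>auto simp: abs_mult intro!: mult_left_le\<close>)
    also have "\<dots> \<le> L2_set (\<lambda>j. sqrt (w j)) {m..<n} * L2_set (Y n) {m..<n}"
      by (rule L2_set_mult_ineq)
    also have "\<dots> \<le> L2_set (\<lambda>j. sqrt (w j)) {m..<n} * 1"
      using Ysum[of "{m..<n}" n] by (intro mult_left_mono) (auto simp: L2_set_def intro!: sum_nonneg)
    also have "\<dots> = sqrt (\<Sum>j=m..<n. w j)"
      using w by (simp add: L2_set_def less_imp_le)
    also have "(\<Sum>j=m..<n. w j) = (\<Sum>j<n - m. w (j + m))"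
      using True sum.shift_bounds_nat_ivl[of w 0 m "n - m"] by (simp add: lessThan_atLeast0)
    also have "\<dots> \<le> tail m"
      unfolding tail_def using sw w
      by (intro sum_le_suminf) (auto simp: summable_iff_shift less_imp_le)
    finally show ?thesis by simp
  next
    case False
    then have "S m n = X n"
      unfolding X_def S_def by (intro sum.mono_neutral_right) (auto simp: Y_def)
    moreover have "0 \<le> tail m"
      unfolding tail_def using sw w
      by (intro suminf_nonneg) (auto simp: summable_iff_shift less_imp_le)
    ultimately show ?thesis by simp
  qed
  have "bounded (range (\<lambda>n. Y n k))" for k
    by (rule boundedI[of _ 1]) (use Ysum[of "{k}"] in \<open>auto simp: abs_square_le_1\<close>)
  then obtain r l where r: "strict_mono r" and l: "\<And>k. (\<lambda>n. Y (r n) k) \<longlonglongrightarrow> l k"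
    using pointwise_convergent_subsequence[of Y] by blast
  have "Cauchy (\<lambda>n. X (r n))"
  proof (rule metric_CauchyI)
    fix e :: real assume e: "e > 0"
    have "(\<lambda>m. sqrt (tail m)) \<longlonglongrightarrow> 0" using tendsto_real_sqrt[OF tail0] by simp
    then have "eventually (\<lambda>m. sqrt (tail m) < e / 4) sequentially"
      using e by (intro order_tendstoD) auto
    then obtain m where m: "sqrt (tail m) < e / 4"
      using eventually_happens by fastforce
    have "(\<lambda>n. S m (r n)) \<longlonglongrightarrow> (\<Sum>j<m. (sqrt (w j) * l j) *\<^sub>R x j)"
      unfolding S_def by (intro tendsto_intros l)
    then have "Cauchy (\<lambda>n. S m (r n))" by (simp add: LIMSEQ_imp_Cauchy)
    then obtain M where M: "\<And>a b. a \<ge> M \<Longrightarrow> b \<ge> M \<Longrightarrow> dist (S m (r a)) (S m (r b)) < e / 2"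
      using metric_CauchyD[of "\<lambda>n. S m (r n)" "e / 2"] e by (auto)
    have "dist (X (r a)) (X (r b)) < e" if ab: "a \<ge> M" "b \<ge> M" for a b
    proof -
      have "dist (X (r a)) (X (r b)) \<le> dist (X (r a)) (S m (r a)) +
          dist (S m (r a)) (S m (r b)) + dist (X (r b)) (S m (r b))"
        using dist_triangle[of "X (r a)" "X (r b)" "S m (r a)"]
          dist_triangle[of "S m (r a)" "X (r b)" "S m (r b)"]
        by (simp add: dist_commute)
      then show ?thesis
        using close[of "r a" m] close[of "r b" m] m M[OF ab] by (simp add: dist_norm)
    qed
    then show "\<exists>M. \<forall>m\<ge>M. \<forall>n\<ge>M. dist (X (r m)) (X (r n)) < e" by blast
  qed
  then obtain z where z: "(\<lambda>n. X (r n)) \<longlonglongrightarrow> z"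
    using compl unfolding complete_def by blast
  show thesis
  proof
    fix i
    have "(\<lambda>n. norm (T i (X (r n)))) \<longlonglongrightarrow> norm (T i z)"
      by (intro tendsto_norm bounded_linear.tendsto[OF T] z)
    moreover have "eventually (\<lambda>n. w i * norm (T i (x i)) \<le> norm (T i (X (r n)))) sequentially"
      using eventually_gt_at_top[of i]
    proof eventually_elim
      case (elim n)
      then show ?case using seq_suble[OF r, of n] by (intro big) simp
    qed
    ultimately show "w i * norm (T i (x i)) \<le> norm (T i z)"
      by (rule tendsto_lowerbound) simp
  qed
qed

lemma almost_norming_vector:
  assumes f: "bounded_linear f" and pos: "onorm f > 0"
  obtains x where "norm x \<le> 1" "norm (f x) > onorm f / 2"
proof -
  have "\<exists>x. norm (f x) > onorm f / 2 * norm x"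
  proof (rule ccontr)
    assume "\<not> ?thesis"
    then have "norm (f x) \<le> onorm f / 2 * norm x" for x by (simp add: not_less)
    then have "onorm f \<le> onorm f / 2" using pos by (intro onorm_bound) auto
    with pos show False by simp
  qed
  then obtain x where x: "norm (f x) > onorm f / 2 * norm x" by blast
  interpret f: bounded_linear f by (rule f)
  have "x \<noteq> 0" using x f.zero by auto
  then have "norm (f (x /\<^sub>R norm x)) > onorm f / 2"
    using x by (simp add: f.scale field_simps)
  moreover have "norm (x /\<^sub>R norm x) \<le> 1" using \<open>x \<noteq> 0\<close> by simp
  ultimately show thesis using that by blast
qed

theorem banach_orbit_to_infinity:
  fixes T :: "nat \<Rightarrow> 'a::real_normed_vector \<Rightarrow> 'b::real_normed_vector"
  assumes compl: "complete (UNIV :: 'a set)"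
    and T: "\<And>k. bounded_linear (T k)"
    and pos: "\<And>k. onorm (T k) > 0" and sm: "summable (\<lambda>k. 1 / onorm (T k))"
  shows "\<exists>z. filterlim (\<lambda>k. norm (T k z)) at_top sequentially"
proof -
  obtain w where w: "\<And>k. w k > 0" "summable w" "suminf w \<le> 1/2"
    and lim: "filterlim (\<lambda>k. w k / (1 / onorm (T k))) at_top sequentially"
    using summable_enlarge[of "\<lambda>k. 1 / onorm (T k)"] pos sm by (metis zero_less_divide_1_iff)
  have "\<exists>x. norm x \<le> 1 \<and> norm (T k x) > onorm (T k) / 2" for k
    using almost_norming_vector[OF T pos] by metis
  then obtain x where x: "\<And>k. norm (x k) \<le> 1" and Tx: "\<And>k. norm (T k (x k)) > onorm (T k) / 2"
    by metis
  have nz: "T k (x k) \<noteq> 0" for k using Tx[of k] pos[of k] by auto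
  have w1: "suminf w \<le> 1" using w(3) by simp
  obtain z where z: "\<And>k. w k * norm (T k (x k)) \<le> norm (T k z)"
    using plank_operators[of T x w, OF compl T x nz w(1,2) w1] by blast
  have "1/2 * (w k / (1 / onorm (T k))) \<le> norm (T k z)" for k
  proof -
    have "w k * (onorm (T k) / 2) \<le> w k * norm (T k (x k))"
      using w(1)[of k] Tx[of k] by (intro mult_left_mono) auto
    then show ?thesis using z[of k] by simp
  qed
  moreover have "filterlim (\<lambda>k. 1/2 * (w k / (1 / onorm (T k)))) at_top sequentially"
    by (rule filterlim_tendsto_pos_mult_at_top[OF tendsto_const _ lim]) simp
  ultimately show ?thesis
    by (intro exI[of _ z]) (rule filterlim_at_top_mono, auto)
qed

section \<open>A plank theorem in complex Hilbert space\<close>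

locale complex_hilbert =
  fixes sc :: "complex \<Rightarrow> 'a::real_normed_vector \<Rightarrow> 'a"
    and ip :: "'a \<Rightarrow> 'a \<Rightarrow> complex"
  assumes complete: "complete (UNIV :: 'a set)"
    and sc_of_real: "sc (of_real r) x = r *\<^sub>R x"
    and ip_add_left: "ip (x + y) z = ip x z + ip y z"
    and ip_sc_left: "ip (sc a x) y = a * ip x y"
    and ip_commute: "ip y x = cnj (ip x y)"
    and ip_self: "ip x x = of_real ((norm x)\<^sup>2)"
begin

lemma ip_add_right: "ip x (y + z) = ip x y + ip x z"
  by (metis ip_add_left ip_commute complex_cnj_add)

lemma ip_sc_right: "ip x (sc a y) = cnj a * ip x y"
  by (metis ip_sc_left ip_commute complex_cnj_mult)

lemma ip_scaleR_left: "ip (r *\<^sub>R x) y = of_real r * ip x y"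
  by (metis ip_sc_left sc_of_real)

lemma ip_scaleR_right: "ip x (r *\<^sub>R y) = of_real r * ip x y"
  by (metis ip_sc_right sc_of_real complex_cnj_complex_of_real)

lemma ip_diff_left: "ip (x - y) z = ip x z - ip y z"
  using ip_add_left[of "x - y" y z] by simp

lemma ip_diff_right: "ip x (y - z) = ip x y - ip x z"
  using ip_add_right[of x "y - z" z] by simp

lemma of_real_norm_sq: "complex_of_real ((norm x)\<^sup>2) = ip x x"
  by (simp add: ip_self)

lemma parallelogram:
  fixes x y :: 'a
  shows "(norm (x + y))\<^sup>2 + (norm (x - y))\<^sup>2 = 2 * (norm x)\<^sup>2 + 2 * (norm y)\<^sup>2"
proof -
  have "complex_of_real ((norm (x + y))\<^sup>2 + (norm (x - y))\<^sup>2) =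
      complex_of_real (2 * (norm x)\<^sup>2 + 2 * (norm y)\<^sup>2)"
    unfolding of_real_add of_real_mult of_real_norm_sq
    by (simp add: ip_add_left ip_add_right ip_diff_left ip_diff_right algebra_simps)
  then show ?thesis by (simp only: of_real_eq_iff)
qed

lemma ip_projection:
  assumes "norm z = 1"
  shows "ip (x - sc (ip x z) z) z = 0"
  using assms by (simp add: ip_diff_left ip_sc_left ip_self)

lemma norm_projection:
  assumes "norm z = 1"
  shows "(norm (x - sc (ip x z) z))\<^sup>2 = (norm x)\<^sup>2 - (cmod (ip x z))\<^sup>2"
proof -
  let ?u = "x - sc (ip x z) z"
  have "complex_of_real ((norm ?u)\<^sup>2) = ip ?u x - cnj (ip x z) * ip ?u z"
    unfolding of_real_norm_sq by (simp add: ip_diff_right ip_sc_right)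
  also have "\<dots> = ip x x - ip x z * cnj (ip x z)"
    using ip_projection[OF assms] by (simp add: ip_diff_left ip_sc_left ip_commute[of z x])
  also have "\<dots> = complex_of_real ((norm x)\<^sup>2 - (cmod (ip x z))\<^sup>2)"
    by (simp only: of_real_diff ip_self complex_norm_square)
  finally show ?thesis by (simp only: of_real_eq_iff)
qed

lemma norm_orthogonal_add:
  assumes "ip u z = 0"
  shows "(norm (z + sc s u))\<^sup>2 = (norm z)\<^sup>2 + (cmod s)\<^sup>2 * (norm u)\<^sup>2"
proof -
  have "ip z u = 0" using assms ip_commute[of z u] by simp
  then have "complex_of_real ((norm (z + sc s u))\<^sup>2) = ip z z + s * cnj s * ip u u"
    unfolding of_real_norm_sq using assms
    by (simp add: ip_add_left ip_add_right ip_sc_left ip_sc_right)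
  also have "\<dots> = complex_of_real ((norm z)\<^sup>2 + (cmod s)\<^sup>2 * (norm u)\<^sup>2)"
    by (simp only: ip_self complex_norm_square of_real_add of_real_mult)
  finally show ?thesis by (simp only: of_real_eq_iff)
qed

lemma cmod_ip_le: "cmod (ip x y) \<le> norm x * norm y"
proof (cases "y = 0")
  case True
  have "ip x 0 = 0" using ip_add_right[of x 0 0] by simp
  with True show ?thesis by simp
next
  case False
  define z where "z = (1 / norm y) *\<^sub>R y"
  have z: "norm z = 1" using False by (simp add: z_def)
  have "(cmod (ip x z))\<^sup>2 \<le> (norm x)\<^sup>2"
    using norm_projection[OF z, of x] by (metis diff_ge_0_iff_ge zero_le_power2)
  then have "cmod (ip x z) \<le> norm x" by (rule power2_le_imp_le) simp
  moreover have "cmod (ip x z) = cmod (ip x y) / norm y"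
    by (simp add: z_def ip_scaleR_right norm_divide)
  ultimately show ?thesis using False by (simp add: field_simps)
qed

lemma bounded_linear_ip_left: "bounded_linear (\<lambda>x. ip x y)"
proof (rule bounded_linear_intro)
  show "cmod (ip x y) \<le> norm x * norm y" for x by (rule cmod_ip_le)
qed (simp_all add: ip_add_left ip_scaleR_left scaleR_conv_of_real)

text \<open>
  This takes the place of weak compactness of the unit ball. Points of almost minimal norm in the
  sets \<open>C m\<close> form a Cauchy sequence: the midpoint of two of them lies in the larger of the two sets,
  so its norm is not much smaller than theirs, and the parallelogram law makes them close.
\<close>

lemma nested_midconvex_nonempty:
  fixes C :: "nat \<Rightarrow> 'a set"
  assumes cl: "\<And>m. closed (C m)" and ne: "\<And>m. C m \<noteq> {}" and anti: "antimono C"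
    and mid: "\<And>m x y. x \<in> C m \<Longrightarrow> y \<in> C m \<Longrightarrow> (1/2) *\<^sub>R (x + y) \<in> C m"
    and bd: "\<And>x. x \<in> C 0 \<Longrightarrow> norm x \<le> B"
  obtains z where "\<And>m. z \<in> C m"
proof -
  define \<delta> where "\<delta> m = (INF x\<in>C m. norm x)" for m
  have bdd: "bdd_below (norm ` C m)" for m by (rule bdd_belowI2[of _ 0]) simp
  have \<delta>le: "\<delta> m \<le> norm x" if "x \<in> C m" for x m
    unfolding \<delta>_def by (rule cINF_lower[OF bdd that])
  have \<delta>0: "0 \<le> \<delta> m" for m
    unfolding \<delta>_def by (rule cINF_greatest[OF ne]) simp
  have "\<exists>x\<in>C m. norm x < \<delta> m + 1 / real (Suc m)" for m
    using cINF_less_iff[OF ne bdd, of m "\<delta> m + 1 / real (Suc m)"] by (simp add: \<delta>_def)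
  then obtain x where xC: "\<And>m. x m \<in> C m" and x\<delta>: "\<And>m. norm (x m) < \<delta> m + 1 / real (Suc m)"
    by metis
  have inc: "incseq \<delta>"
    unfolding incseq_def \<delta>_def
    using cINF_superset_mono[OF ne bdd antimonoD[OF anti]] by blast
  have "\<delta> m \<le> B" for m
  proof -
    have "x m \<in> C 0" using xC[of m] antimonoD[OF anti, of 0 m] by blast
    then show ?thesis using \<delta>le[OF xC, of m] bd[of "x m"] by linarith
  qed
  then obtain L where L: "\<delta> \<longlonglongrightarrow> L"
    using incseq_convergent[OF inc, of B] by blast
  have nL: "(\<lambda>m. norm (x m)) \<longlonglongrightarrow> L"
  proof (rule tendsto_sandwich[OF _ _ L])
    show "eventually (\<lambda>m. \<delta> m \<le> norm (x m)) sequentially" using \<delta>le xC by simp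
    show "eventually (\<lambda>m. norm (x m) \<le> \<delta> m + 1 / real (Suc m)) sequentially"
      using x\<delta> by (simp add: less_imp_le)
    show "(\<lambda>m. \<delta> m + 1 / real (Suc m)) \<longlonglongrightarrow> L"
      using tendsto_add[OF L LIMSEQ_inverse_real_of_nat] by (simp add: inverse_eq_divide)
  qed
  have gap: "(norm (x j - x m))\<^sup>2 \<le> 2 * (norm (x j))\<^sup>2 + 2 * (norm (x m))\<^sup>2 - 4 * (\<delta> m)\<^sup>2"
    if "m \<le> j" for m j
  proof -
    have "(1/2) *\<^sub>R (x j + x m) \<in> C m"
      using xC[of j] xC[of m] antimonoD[OF anti that] by (intro mid) auto
    from \<delta>le[OF this] have "2 * \<delta> m \<le> norm (x j + x m)" by simp
    then have "(2 * \<delta> m)\<^sup>2 \<le> (norm (x j + x m))\<^sup>2" using \<delta>0 by (intro power_mono) auto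
    then show ?thesis using parallelogram[of "x j" "x m"] by (simp add: power_mult_distrib)
  qed
  have "Cauchy x"
  proof (rule metric_CauchyI)
    fix e :: real assume e: "e > 0"
    define \<eta> where "\<eta> = e\<^sup>2 / 8"
    have \<eta>: "\<eta> > 0" using e by (simp add: \<eta>_def)
    have "eventually (\<lambda>m. (norm (x m))\<^sup>2 < L\<^sup>2 + \<eta>) sequentially"
      using tendsto_power[OF nL, of 2] \<eta> by (intro order_tendstoD(2)) auto
    moreover have "eventually (\<lambda>m. (\<delta> m)\<^sup>2 > L\<^sup>2 - \<eta>) sequentially"
      using tendsto_power[OF L, of 2] \<eta> by (intro order_tendstoD(1)) auto
    ultimately have "eventually (\<lambda>m. (norm (x m))\<^sup>2 < L\<^sup>2 + \<eta> \<and> (\<delta> m)\<^sup>2 > L\<^sup>2 - \<eta>) sequentially"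
      by eventually_elim simp
    then obtain M where M: "\<And>m. m \<ge> M \<Longrightarrow> (norm (x m))\<^sup>2 < L\<^sup>2 + \<eta>"
      "\<And>m. m \<ge> M \<Longrightarrow> (\<delta> m)\<^sup>2 > L\<^sup>2 - \<eta>"
      unfolding eventually_sequentially by blast
    have close: "dist (x j) (x m) < e" if "m \<ge> M" "j \<ge> m" for m j
    proof -
      have "(norm (x j - x m))\<^sup>2 < 8 * \<eta>"
        using gap[OF that(2)] M(1)[of j] M[of m] that by simp
      then have "(norm (x j - x m))\<^sup>2 < e\<^sup>2" by (simp add: \<eta>_def)
      then show ?thesis using e by (simp add: dist_norm power2_less_imp_less)
    qed
    have "dist (x m) (x n) < e" if "m \<ge> M" "n \<ge> M" for m n
      using close[of m n] close[of n m] that by (cases "m \<le> n") (auto simp: dist_commute)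
    then show "\<exists>M. \<forall>m\<ge>M. \<forall>n\<ge>M. dist (x m) (x n) < e" by blast
  qed
  then obtain z where z: "x \<longlonglongrightarrow> z" using complete unfolding complete_def by blast
  have "z \<in> C m" for m
  proof (rule Lim_in_closed_set[OF cl _ _ z])
    show "eventually (\<lambda>j. x j \<in> C m) sequentially"
      using eventually_ge_at_top[of m]
      by eventually_elim (use xC antimonoD[OF anti] in blast)
  qed simp
  with that show thesis by blast
qed

definition functional :: "('a \<Rightarrow> complex) \<Rightarrow> bool" where
  "functional \<phi> \<longleftrightarrow> bounded_linear \<phi> \<and> (\<forall>a x. \<phi> (sc a x) = a * \<phi> x)"

text \<open>
  Given a vector on which the earlier functionals do not vanish, all but finitely many real
  multiples of \<open>x n\<close> can be added to it.
\<close>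

lemma common_nonzero:
  fixes n :: nat
  assumes \<phi>: "\<And>k. functional (\<phi> k)" and x: "\<And>k. \<phi> k (x k) = 1"
  shows "\<exists>z. \<forall>k<n. \<phi> k z \<noteq> 0"
proof (induction n)
  case (Suc n)
  then obtain z where z: "\<And>k. k < n \<Longrightarrow> \<phi> k z \<noteq> 0" by blast
  have finite_roots: "finite {s :: real. a + of_real s * b = 0}" if "a \<noteq> 0 \<or> b \<noteq> 0" for a b :: complex
  proof (cases "b = 0")
    case False
    have "{s :: real. a + of_real s * b = 0} \<subseteq> {Re (- a / b)}"
    proof
      fix s :: real assume "s \<in> {s. a + of_real s * b = 0}"
      then have "of_real s = - a / b" using False by (simp add: field_simps add_eq_0_iff)
      then show "s \<in> {Re (- a / b)}" by (metis Re_complex_of_real singletonI)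
    qed
    then show ?thesis by (rule finite_subset) simp
  qed (use that in simp)
  have "finite (\<Union>k<Suc n. {s :: real. \<phi> k z + of_real s * \<phi> k (x n) = 0})"
    using z x[of n] by (intro finite_UN_I finite_roots) (auto simp: less_Suc_eq)
  then obtain s :: real where s: "s \<notin> (\<Union>k<Suc n. {s :: real. \<phi> k z + of_real s * \<phi> k (x n) = 0})"
    using ex_new_if_finite[OF infinite_UNIV_char_0] by blast
  have "\<phi> k (z + s *\<^sub>R x n) = \<phi> k z + of_real s * \<phi> k (x n)" for k
    using \<phi>[of k] by (simp add: functional_def linear_simps scaleR_conv_of_real)
  with s show ?case by (intro exI[of _ "z + s *\<^sub>R x n"]) auto
qed simp

text \<open>
  Let \<open>N = \<Sum>\<^sub>k m\<^sub>k\<close> and let \<open>z\<close> be a unit vector at which \<open>P z = \<Prod>\<^sub>k \<bar>\<phi>\<^sub>k z\<bar> ^ m\<^sub>k\<close> is at least half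
  of its supremum on the unit sphere. Fix \<open>k\<close>, let \<open>u\<close> be the component of \<open>x\<^sub>k\<close> orthogonal to
  \<open>z\<close>, and put \<open>r\<^sup>2 = m\<^sub>k / N\<close>, which is at least \<open>t\<^sub>k\<^sup>2\<close>. For \<open>\<bar>s\<bar> = r\<close> we have
  \<open>\<parallel>z + su\<parallel>\<^sup>N \<le> (1 + r\<^sup>2)\<^sup>N\<^sup>/\<^sup>2 \<le> exp (m\<^sub>k / 2)\<close>, hence
  \<open>P (z + su) \<le> 2 P z exp (m\<^sub>k / 2)\<close>. If
  \<open>\<bar>\<phi>\<^sub>k z\<bar>\<close> were less than \<open>r / 6\<close>, then \<open>\<bar>\<phi>\<^sub>k (z + su)\<bar> \<ge> 2r/3\<close> on this circle. Dividing out the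
  factor of \<open>\<phi>\<^sub>k\<close> leaves a polynomial \<open>q\<close> in \<open>s\<close> that is too small on the circle for its value
  \<open>\<bar>q 0\<bar> = P z / \<bar>\<phi>\<^sub>k z\<bar> ^ m\<^sub>k\<close> at the centre.
\<close>

lemma plank_functionals_finite:
  fixes t :: "nat \<Rightarrow> real"
  assumes \<phi>: "\<And>k. functional (\<phi> k)" and x: "\<And>k. norm (x k) \<le> 1" and \<phi>x: "\<And>k. \<phi> k (x k) = 1"
    and t: "\<And>k. t k > 0" and t1: "(\<Sum>k<n. (t k)\<^sup>2) \<le> 1/2"
  obtains z where "norm z \<le> 1" "\<And>k. k < n \<Longrightarrow> t k / 6 \<le> cmod (\<phi> k z)"
proof (cases "n = 0")
  case True
  with that[of 0] show thesis by simp
next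
  case False
  have lin: "\<phi> k (v + sc s u) = \<phi> k v + s * \<phi> k u" "\<phi> k (v - sc s u) = \<phi> k v - s * \<phi> k u"
    "\<phi> k (sc s u) = s * \<phi> k u" for k v s u
    using \<phi>[of k] by (auto simp: functional_def linear_simps)
  \<comment> \<open>Rounding up adds at most \<open>n\<close> to the total \<open>2n \<Sum>\<^sub>k t\<^sub>k\<^sup>2 \<le> n\<close>, so that \<open>N \<le> 2n\<close>
    and \<open>m\<^sub>k / N \<ge> t\<^sub>k\<^sup>2\<close>.\<close>
  define m where "m k = nat \<lceil>2 * real n * (t k)\<^sup>2\<rceil>" for k
  define N where "N = (\<Sum>k<n. m k)"
  have m_ge: "2 * real n * (t k)\<^sup>2 \<le> real (m k)" for k by (simp add: m_def real_nat_ceiling_ge)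
  have m_pos: "m k > 0" for k using t[of k] False by (simp add: m_def)
  have m_ub: "real (m k) \<le> 2 * real n * (t k)\<^sup>2 + 1" for k
  proof -
    have "0 \<le> 2 * real n * (t k)\<^sup>2" by simp
    then have "real (m k) = of_int \<lceil>2 * real n * (t k)\<^sup>2\<rceil>"
      unfolding m_def by (intro of_nat_nat) linarith
    then show ?thesis using ceiling_correct[of "2 * real n * (t k)\<^sup>2"] by linarith
  qed
  have "real N \<le> (\<Sum>k<n. 2 * real n * (t k)\<^sup>2 + 1)"
    unfolding N_def of_nat_sum by (intro sum_mono m_ub)
  also have "\<dots> = 2 * real n * (\<Sum>k<n. (t k)\<^sup>2) + real n" by (simp add: sum.distrib sum_distrib_left)
  also have "\<dots> \<le> 2 * real n" using mult_left_mono[OF t1, of "2 * real n"] by simp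
  finally have N_le: "real N \<le> 2 * real n" .
  have m_le: "m k \<le> N" if "k < n" for k
    unfolding N_def using that by (intro member_le_sum) auto
  have N_pos: "N > 0" using m_le[of 0] m_pos[of 0] False by simp
  define P where "P v = (\<Prod>k<n. cmod (\<phi> k v) ^ m k)" for v
  have P_sc: "P (sc a v) = cmod a ^ N * P v" for a v
    by (simp add: P_def lin norm_mult power_mult_distrib prod.distrib N_def power_sum)
  have P_nonneg: "P v \<ge> 0" for v unfolding P_def by (intro prod_nonneg) auto
  have normalise: "sc (of_real (norm v)) (v /\<^sub>R norm v) = v" if "v \<noteq> 0" for v
    using that by (simp add: sc_of_real)
  define S where "S = (SUP v\<in>{v. norm v = 1}. P v)"
  have "P v \<le> (\<Prod>k<n. onorm (\<phi> k) ^ m k)" if "norm v = 1" for v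
    unfolding P_def
  proof (intro prod_mono conjI power_mono)
    show "cmod (\<phi> k v) \<le> onorm (\<phi> k)" for k
      using onorm[of "\<phi> k" v] \<phi>[of k] that by (simp add: functional_def)
  qed auto
  then have bdd: "bdd_above (P ` {v. norm v = 1})" by (intro bdd_aboveI2) auto
  have S_ub: "P v \<le> S" if "norm v = 1" for v
    unfolding S_def by (rule cSUP_upper) (use that bdd in auto)
  have P_le: "P v \<le> S * norm v ^ N" if "v \<noteq> 0" for v
  proof -
    have "P v = norm v ^ N * P (v /\<^sub>R norm v)"
      using P_sc[of "of_real (norm v)" "v /\<^sub>R norm v"] normalise[OF that] by simp
    also have "\<dots> \<le> norm v ^ N * S"
      using that by (intro mult_left_mono S_ub) auto
    finally show ?thesis by (simp add: mult.commute)
  qed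
  obtain v0 where v0: "\<And>k. k < n \<Longrightarrow> \<phi> k v0 \<noteq> 0"
    using common_nonzero[of \<phi> x n] \<phi> \<phi>x by blast
  have "P v0 > 0" unfolding P_def using v0 by (intro prod_pos) auto
  moreover have "v0 \<noteq> 0"
    using v0[of 0] False linear_0[OF bounded_linear.linear, of "\<phi> 0"] \<phi>[of 0]
    by (auto simp: functional_def)
  ultimately have "0 < S * norm v0 ^ N" using P_le[of v0] by linarith
  then have S_pos: "S > 0" using \<open>v0 \<noteq> 0\<close> by (simp add: zero_less_mult_iff)
  have "\<exists>v\<in>{v. norm v = 1}. S / 2 < P v"
  proof -
    have "v0 /\<^sub>R norm v0 \<in> {v. norm v = 1}" using \<open>v0 \<noteq> 0\<close> by simp
    then have "{v :: 'a. norm v = 1} \<noteq> {}" by blast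
    then show ?thesis
      using less_cSUP_iff[OF _ bdd, of "S / 2"] S_pos by (simp flip: S_def)
  qed
  then obtain z where z: "norm z = 1" and Pz: "S / 2 < P z" by blast
  have "t k / 6 \<le> cmod (\<phi> k z)" if k: "k < n" for k
  proof -
    define r where "r = sqrt (real (m k) / real N)"
    have r2: "r\<^sup>2 = real (m k) / real N" by (simp add: r_def)
    have r_pos: "r > 0" using m_pos[of k] N_pos by (simp add: r_def)
    have r_le: "r \<le> 1" using m_le[OF k] N_pos by (simp add: r_def)
    have "(t k)\<^sup>2 \<le> r\<^sup>2"
    proof -
      have "(t k)\<^sup>2 * real N \<le> (t k)\<^sup>2 * (2 * real n)" using N_le by (intro mult_left_mono) auto
      also have "\<dots> \<le> real (m k)" using m_ge[of k] by (simp add: algebra_simps)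
      finally show ?thesis using N_pos by (simp add: r2 pos_le_divide_eq)
    qed
    then have t_le: "t k \<le> r" by (rule power2_le_imp_le) (use r_pos in simp)
    define c where "c = \<phi> k z"
    have "r / 6 \<le> cmod c"
    proof (rule ccontr)
      assume "\<not> r / 6 \<le> cmod c"
      then have c_less: "cmod c < r / 6" by simp
      define u where "u = x k - sc (ip (x k) z) z"
      have uz: "ip u z = 0" unfolding u_def by (rule ip_projection[OF z])
      have u2: "(norm u)\<^sup>2 = (norm (x k))\<^sup>2 - (cmod (ip (x k) z))\<^sup>2"
        unfolding u_def by (rule norm_projection[OF z])
      have u_le: "(norm u)\<^sup>2 \<le> 1"
      proof -
        have "(norm (x k))\<^sup>2 \<le> 1" using x[of k] by (simp add: abs_square_le_1)
        then show ?thesis using u2 zero_le_power2[of "cmod (ip (x k) z)"] by linarith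
      qed
      have "\<phi> k u = 1 - ip (x k) z * c" by (simp add: u_def lin \<phi>x c_def)
      moreover have "cmod (ip (x k) z * c) \<le> 1/6"
      proof -
        have "cmod (ip (x k) z) \<le> 1" using cmod_ip_le[of "x k" z] x[of k] z by simp
        then have "cmod (ip (x k) z) * cmod c \<le> 1 * (1/6)"
          using c_less r_le by (intro mult_mono) auto
        then show ?thesis by (simp add: norm_mult)
      qed
      ultimately have d: "cmod (\<phi> k u) \<ge> 5/6"
        using norm_triangle_ineq2[of 1 "ip (x k) z * c"] by simp
      define q where "q s = (\<Prod>j\<in>{..<n} - {k}. (\<phi> j z + s * \<phi> j u) ^ m j)" for s
      have P_split: "P (z + sc s u) = cmod (c + s * \<phi> k u) ^ m k * cmod (q s)" for s
        unfolding P_def q_def c_def using k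
        by (subst prod.remove[of _ k]) (auto simp: lin norm_power norm_mult simp flip: prod_norm)
      have Pz_split: "P z = cmod c ^ m k * cmod (q 0)"
        unfolding P_def q_def c_def using k
        by (subst prod.remove[of _ k]) (auto simp: norm_power simp flip: prod_norm)
      have Pz_pos: "P z > 0" using Pz S_pos by linarith
      have c_pos: "cmod c > 0"
        using Pz_pos Pz_split m_pos[of k] by (cases "c = 0") (auto simp: zero_power)
      let ?E = "2 * P z * (exp (1/2) / (2 * r / 3)) ^ m k"
      have circle: "cmod (q s) \<le> ?E" if s: "cmod s = r" for s
      proof -
        have "(norm (z + sc s u))\<^sup>2 = 1 + r\<^sup>2 * (norm u)\<^sup>2"
          using norm_orthogonal_add[OF uz, of s] z s by simp
        also have "\<dots> \<le> 1 + r\<^sup>2" using u_le by (simp add: mult_left_le)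
        also have "\<dots> \<le> exp (r\<^sup>2)" by (rule exp_ge_add_one_self)
        also have "\<dots> = (exp (r\<^sup>2 / 2))\<^sup>2" by (simp flip: exp_double)
        finally have "norm (z + sc s u) \<le> exp (r\<^sup>2 / 2)" by (rule power2_le_imp_le) simp
        then have "norm (z + sc s u) ^ N \<le> exp (r\<^sup>2 / 2) ^ N" by (intro power_mono) auto
        also have "\<dots> = exp (real N * (r\<^sup>2 / 2))" by (rule exp_of_nat_mult[symmetric])
        also have "real N * (r\<^sup>2 / 2) = real (m k) * (1/2)" using N_pos by (simp add: r2)
        also have "exp \<dots> = exp (1/2) ^ m k" by (rule exp_of_nat_mult)
        finally have normN: "norm (z + sc s u) ^ N \<le> exp (1/2) ^ m k" .
        have "norm (z + sc s u) \<noteq> 0"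
          using norm_orthogonal_add[OF uz, of s] z
          by (smt (verit) mult_nonneg_nonneg power_zero_numeral power_one zero_le_power2)
        then have "P (z + sc s u) \<le> S * norm (z + sc s u) ^ N" by (intro P_le) auto
        also have "\<dots> \<le> (2 * P z) * exp (1/2) ^ m k"
          using normN Pz S_pos by (intro mult_mono) auto
        finally have up: "P (z + sc s u) \<le> 2 * P z * exp (1/2) ^ m k" .
        have "2 * r / 3 \<le> r * (5/6) - r / 6" by simp
        also have "\<dots> \<le> cmod (s * \<phi> k u) - cmod c"
          using mult_left_mono[OF d less_imp_le[OF r_pos]] c_less by (simp add: norm_mult s)
        also have "\<dots> \<le> cmod (c + s * \<phi> k u)"
          using norm_diff_ineq[of "s * \<phi> k u" c] by (simp add: add.commute)
        finally have "(2 * r / 3) ^ m k \<le> cmod (c + s * \<phi> k u) ^ m k"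
          using r_pos by (intro power_mono) auto
        then have "(2 * r / 3) ^ m k * cmod (q s) \<le> P (z + sc s u)"
          unfolding P_split by (intro mult_right_mono) auto
        with up have "(2 * r / 3) ^ m k * cmod (q s) \<le> 2 * P z * exp (1/2) ^ m k" by linarith
        then show ?thesis using r_pos by (simp add: power_divide field_simps)
      qed
      have "cmod (q 0) \<le> ?E"
      proof (rule maximum_modulus_frontier[of q "cball 0 r"])
        show "q holomorphic_on interior (cball 0 r)"
          unfolding q_def by (intro holomorphic_intros)
        show "continuous_on (closure (cball 0 r)) q"
          unfolding q_def by (intro continuous_intros)
        show "cmod (q s) \<le> ?E" if "s \<in> frontier (cball 0 r)" for s
          using that r_pos by (intro circle) (simp add: frontier_cball)
      qed (use r_pos in auto)
      then have "P z \<le> cmod c ^ m k * ?E"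
        unfolding Pz_split using c_pos by (intro mult_left_mono) auto
      also have "\<dots> = P z * (2 * (cmod c * (exp (1/2) / (2 * r / 3))) ^ m k)"
        by (simp only: power_mult_distrib mult_ac)
      finally have "1 \<le> 2 * (cmod c * (exp (1/2) / (2 * r / 3))) ^ m k"
        using Pz_pos by simp
      \<comment> \<open>The constant \<open>6\<close> is chosen for this step: \<open>e\<^sup>1\<^sup>/\<^sup>2 \<le> 2\<close> and \<open>r/6 \<cdot> 2 / (2r/3) = 1/2\<close>.\<close>
      also have "\<dots> < 2 * (1/2) ^ m k"
      proof -
        have "exp (1/2 :: real) \<le> 2"
        proof (rule power2_le_imp_le)
          show "(exp (1/2))\<^sup>2 \<le> (2::real)\<^sup>2" using exp_le by (simp flip: exp_double)
        qed simp
        then have "cmod c * (exp (1/2) / (2 * r / 3)) \<le> cmod c * (2 / (2 * r / 3))"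
          using r_pos by (intro mult_left_mono divide_right_mono) auto
        also have "\<dots> < r / 6 * (2 / (2 * r / 3))"
          using c_less r_pos by (intro mult_strict_right_mono) auto
        also have "\<dots> = 1/2" using r_pos by simp
        finally have "cmod c * (exp (1/2) / (2 * r / 3)) < 1/2" .
        then show ?thesis using r_pos m_pos[of k]
          by (intro mult_strict_left_mono power_strict_mono) auto
      qed
      also have "\<dots> \<le> 2 * (1/2) ^ 1"
        using m_pos[of k] by (intro mult_left_mono power_decreasing) auto
      finally show False by simp
    qed
    with t_le show ?thesis by (simp add: c_def)
  qed
  with that[of z] z show thesis by simp
qed

text \<open>
  Along a subsequence of the finite solutions all the values \<open>\<phi>\<^sub>k\<close> converge, say to \<open>l\<^sub>k\<close>. The
  lower bounds are not convex conditions on a vector, but \<open>\<phi>\<^sub>k z = l\<^sub>k\<close> is; the vector \<open>z\<close> is found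
  in the intersection of the nested convex sets of its approximate solutions in the unit ball.
\<close>

theorem plank_functionals:
  fixes t :: "nat \<Rightarrow> real"
  assumes \<phi>: "\<And>k. functional (\<phi> k)" and x: "\<And>k. norm (x k) \<le> 1" and \<phi>x: "\<And>k. \<phi> k (x k) = 1"
    and t: "\<And>k. t k > 0" and st: "summable (\<lambda>k. (t k)\<^sup>2)" and t1: "(\<Sum>k. (t k)\<^sup>2) \<le> 1/2"
  obtains z where "\<And>k. t k / 6 \<le> cmod (\<phi> k z)"
proof -
  have "\<exists>z. norm z \<le> 1 \<and> (\<forall>k<n. t k / 6 \<le> cmod (\<phi> k z))" for n
  proof -
    have "(\<Sum>k<n. (t k)\<^sup>2) \<le> (\<Sum>k. (t k)\<^sup>2)" by (intro sum_le_suminf st) auto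
    then have "(\<Sum>k<n. (t k)\<^sup>2) \<le> 1/2" using t1 by linarith
    from plank_functionals_finite[of \<phi> x t n, OF \<phi> x \<phi>x t this] show ?thesis by blast
  qed
  then obtain Z where Z: "\<And>n. norm (Z n) \<le> 1" and big: "\<And>n k. k < n \<Longrightarrow> t k / 6 \<le> cmod (\<phi> k (Z n))"
    by metis
  have bl: "bounded_linear (\<phi> k)" for k using \<phi> by (simp add: functional_def)
  have "bounded (range (\<lambda>n. \<phi> k (Z n)))" for k
  proof (rule boundedI)
    fix y assume "y \<in> range (\<lambda>n. \<phi> k (Z n))"
    then obtain n where "y = \<phi> k (Z n)" by blast
    then have "norm y \<le> onorm (\<phi> k) * norm (Z n)" using onorm[OF bl] by simp
    also have "\<dots> \<le> onorm (\<phi> k) * 1" using Z onorm_pos_le[OF bl] by (intro mult_left_mono) auto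
    finally show "norm y \<le> onorm (\<phi> k)" by simp
  qed
  then obtain r l where r: "strict_mono r" and l: "\<And>k. (\<lambda>n. \<phi> k (Z (r n))) \<longlonglongrightarrow> l k"
    using pointwise_convergent_subsequence[of "\<lambda>n k. \<phi> k (Z n)"] by blast
  have l_big: "t k / 6 \<le> cmod (l k)" for k
  proof (rule tendsto_lowerbound[OF tendsto_norm[OF l]])
    show "eventually (\<lambda>n. t k / 6 \<le> cmod (\<phi> k (Z (r n)))) sequentially"
      using eventually_gt_at_top[of k]
    proof eventually_elim
      case (elim n)
      then show ?case using seq_suble[OF r, of n] by (intro big) simp
    qed
  qed simp
  define C where "C m = {z. norm z \<le> 1 \<and> (\<forall>k<m. cmod (\<phi> k z - l k) \<le> 1 / real (Suc m))}" for m
  obtain z where z: "\<And>m. z \<in> C m"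
  proof (rule nested_midconvex_nonempty[of C 1])
    show "closed (C m)" for m
      unfolding C_def
      by (intro closed_Collect_conj closed_Collect_all closed_Collect_imp open_Collect_const
          closed_Collect_le continuous_intros bounded_linear.continuous_on[OF bl])
    show "C m \<noteq> {}" for m
    proof -
      have "eventually (\<lambda>n. \<forall>k\<in>{..<m}. cmod (\<phi> k (Z (r n)) - l k) < 1 / real (Suc m)) sequentially"
        unfolding eventually_ball_finite_distrib[OF finite_lessThan]
        using l by (auto simp: tendsto_iff dist_norm)
      then obtain n where "\<forall>k\<in>{..<m}. cmod (\<phi> k (Z (r n)) - l k) < 1 / real (Suc m)"
        using eventually_happens by fastforce
      then have "Z (r n) \<in> C m" using Z by (auto simp: C_def less_imp_le)
      then show ?thesis by blast
    qed
    show "antimono C"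
    proof (rule antimonoI)
      fix a b :: nat assume ab: "a \<le> b"
      then have "1 / real (Suc b) \<le> 1 / real (Suc a)" by (simp add: frac_le)
      with ab show "C b \<subseteq> C a"
        unfolding C_def by (intro Collect_mono) (meson order_less_le_trans order_trans)
    qed
    show "(1/2) *\<^sub>R (a + b) \<in> C m" if ab: "a \<in> C m" "b \<in> C m" for m a b
    proof -
      have "norm ((1/2) *\<^sub>R (a + b)) \<le> 1"
        using ab norm_triangle_ineq[of a b] by (simp add: C_def)
      moreover have "cmod (\<phi> k ((1/2) *\<^sub>R (a + b)) - l k) \<le> 1 / real (Suc m)" if k: "k < m" for k
      proof -
        have "\<phi> k ((1/2) *\<^sub>R (a + b)) - l k = (1/2) *\<^sub>R ((\<phi> k a - l k) + (\<phi> k b - l k))"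
          using bl[of k] by (simp add: linear_simps scaleR_conv_of_real algebra_simps)
        also have "norm \<dots> \<le> (1/2) * (cmod (\<phi> k a - l k) + cmod (\<phi> k b - l k))"
          using norm_triangle_ineq[of "\<phi> k a - l k" "\<phi> k b - l k"] by simp
        also have "\<dots> \<le> (1/2) * (1 / real (Suc m) + 1 / real (Suc m))"
        proof (intro mult_left_mono add_mono)
          show "cmod (\<phi> k a - l k) \<le> 1 / real (Suc m)" "cmod (\<phi> k b - l k) \<le> 1 / real (Suc m)"
            using ab k unfolding C_def by blast+
        qed simp
        finally show ?thesis by simp
      qed
      ultimately show ?thesis by (simp add: C_def)
    qed
  qed (auto simp: C_def)
  have "\<phi> k z = l k" for k
  proof -
    have "cmod (\<phi> k z - l k) \<le> 0"
    proof (rule tendsto_lowerbound)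
      show "(\<lambda>m. 1 / real (Suc m)) \<longlonglongrightarrow> 0"
        using LIMSEQ_inverse_real_of_nat by (simp add: inverse_eq_divide)
      show "eventually (\<lambda>m. cmod (\<phi> k z - l k) \<le> 1 / real (Suc m)) sequentially"
        using eventually_gt_at_top[of k] by eventually_elim (use z in \<open>auto simp: C_def\<close>)
    qed simp
    then show ?thesis by simp
  qed
  then show thesis using l_big that[of z] by simp
qed

text \<open>
  The functional that belongs to \<open>T\<^sub>k\<close> is the inner product of \<open>T\<^sub>k v\<close> with \<open>T\<^sub>k x\<^sub>k\<close>, normalised
  to be \<open>1\<close> at \<open>x\<^sub>k\<close>.
\<close>

theorem hilbert_orbit_to_infinity:
  fixes T :: "nat \<Rightarrow> 'a \<Rightarrow> 'a"
  assumes T: "\<And>k. bounded_linear (T k)" and Tsc: "\<And>k a v. T k (sc a v) = sc a (T k v)"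
    and pos: "\<And>k. onorm (T k) > 0" and sm: "summable (\<lambda>k. 1 / (onorm (T k))\<^sup>2)"
  shows "\<exists>z. filterlim (\<lambda>k. norm (T k z)) at_top sequentially"
proof -
  have pos2: "1 / (onorm (T k))\<^sup>2 > 0" for k using pos[of k] by simp
  obtain w where w: "\<And>k. w k > 0" "summable w" "suminf w \<le> 1/2"
    and lim: "filterlim (\<lambda>k. w k / (1 / (onorm (T k))\<^sup>2)) at_top sequentially"
    using summable_enlarge[of "\<lambda>k. 1 / (onorm (T k))\<^sup>2", OF pos2 sm] by blast
  have "\<exists>x. norm x \<le> 1 \<and> norm (T k x) > onorm (T k) / 2" for k
    using almost_norming_vector[OF T pos] by metis
  then obtain x where x: "\<And>k. norm (x k) \<le> 1" and Tx: "\<And>k. norm (T k (x k)) > onorm (T k) / 2"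
    by metis
  define y where "y k = T k (x k)" for k
  have y: "norm (y k) > 0" for k using Tx[of k] pos[of k] unfolding y_def by linarith
  define \<phi> where "\<phi> k v = ip (T k v) (y k) / of_real ((norm (y k))\<^sup>2)" for k v
  have \<phi>: "functional (\<phi> k)" for k
    unfolding functional_def
  proof (intro conjI allI)
    show "bounded_linear (\<phi> k)"
      unfolding \<phi>_def
      using bounded_linear_compose[OF bounded_linear_divide
          bounded_linear_compose[OF bounded_linear_ip_left T]] by (simp add: o_def)
    show "\<phi> k (sc a v) = a * \<phi> k v" for a v by (simp add: \<phi>_def Tsc ip_sc_left)
  qed
  have \<phi>x: "\<phi> k (x k) = 1" for k using y[of k] by (simp add: \<phi>_def ip_self flip: y_def)
  have sq: "(sqrt (w k))\<^sup>2 = w k" for k using w(1)[of k] by simp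
  have "sqrt (w k) > 0" for k using w(1)[of k] by simp
  then obtain z where z: "\<And>k. sqrt (w k) / 6 \<le> cmod (\<phi> k z)"
    using plank_functionals[of \<phi> x "\<lambda>k. sqrt (w k)"] \<phi> x \<phi>x w(2,3) unfolding sq by blast
  have "1/12 * sqrt (w k / (1 / (onorm (T k))\<^sup>2)) \<le> norm (T k z)" for k
  proof -
    have "cmod (\<phi> k z) * (norm (y k))\<^sup>2 \<le> norm (T k z) * norm (y k)"
      using cmod_ip_le[of "T k z" "y k"] y[of k] by (simp add: \<phi>_def norm_divide norm_power)
    then have "cmod (\<phi> k z) * norm (y k) \<le> norm (T k z)"
      using y[of k] by (simp add: power2_eq_square flip: mult.assoc)
    moreover have "sqrt (w k) / 6 * (onorm (T k) / 2) \<le> cmod (\<phi> k z) * norm (y k)"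
      using z[of k] Tx[of k] pos[of k] by (intro mult_mono) (auto simp: y_def)
    moreover have "sqrt (w k / (1 / (onorm (T k))\<^sup>2)) = sqrt (w k) * onorm (T k)"
      using pos[of k] by (simp add: real_sqrt_mult)
    ultimately show ?thesis by simp
  qed
  moreover have "filterlim (\<lambda>k. 1/12 * sqrt (w k / (1 / (onorm (T k))\<^sup>2))) at_top sequentially"
    by (intro filterlim_tendsto_pos_mult_at_top[OF tendsto_const]
        filterlim_compose[OF sqrt_at_top lim]) simp
  ultimately show ?thesis
    by (intro exI[of _ z]) (rule filterlim_at_top_mono, auto)
qed

end

section \<open>Orbits of powers of an unbounded operator\<close>

text \<open>
  Finiteness of the series in \<^typ>\<open>ennreal\<close> contains that no \<open>M k\<close> vanishes, since \<open>1 / 0 = \<infinity>\<close>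
  there.
\<close>

lemma ennreal_reciprocal_series:
  fixes M :: "nat \<Rightarrow> real"
  assumes nonneg: "\<And>k. M k \<ge> 0" and p: "p > 0"
    and fin: "(\<Sum>k. 1 / (ennreal (M k)) ^ p) < \<infinity>"
  shows "M k > 0" and "summable (\<lambda>k. 1 / M k ^ p)"
proof -
  have pos: "M k > 0" for k
  proof (rule ccontr)
    assume "\<not> M k > 0"
    then have "1 / (ennreal (M k)) ^ p = \<infinity>"
      using nonneg[of k] p by (simp add: zero_power ennreal_divide_zero)
    moreover have "1 / (ennreal (M k)) ^ p \<le> (\<Sum>k. 1 / (ennreal (M k)) ^ p)"
      using sum_le_suminf[of "\<lambda>k. 1 / (ennreal (M k)) ^ p" "{k}"] by simp
    ultimately show False using fin by simp
  qed
  show "M k > 0" by (rule pos)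
  have "1 / (ennreal (M k)) ^ p = ennreal (1 / M k ^ p)" for k
  proof -
    have "ennreal (1 / M k ^ p) = ennreal 1 / ennreal (M k ^ p)"
      using pos[of k] by (intro divide_ennreal[symmetric]) auto
    then show ?thesis using nonneg by (simp add: ennreal_power)
  qed
  with fin have "(\<Sum>k. ennreal (1 / M k ^ p)) \<noteq> top" by simp
  then show "summable (\<lambda>k. 1 / M k ^ p)"
    using pos by (intro summable_suminf_not_top) (auto simp: less_imp_le)
qed

theorem corollary4p8:
  fixes K :: "complex set"
    and sc :: "complex \<Rightarrow> 'a::real_normed_vector \<Rightarrow> 'a"
    and D :: "'a set"
    and T C :: "'a \<Rightarrow> 'a"
  assumes "normed_space_over K sc"
    and "\<exists>x::'a. x \<noteq> 0"
    and "linear_operator K sc D T"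
    and "C \<in> bounded_operators K sc"
    and "inj C"
    and "range C \<subseteq> dom_infinity D T"
    and "\<forall>k::nat. (T ^^ k) \<circ> C \<in> bounded_operators K sc"
    and "(banach_condition T C \<and> \<not> hilbert_condition K sc T C) \<or>
         (hilbert_condition K sc T C \<and> \<not> banach_condition T C)"
  shows "\<exists>x. filterlim (\<lambda>k. norm ((T ^^ k) (C x))) at_top sequentially"
proof -
  define S where "S k = (T ^^ Suc k) \<circ> C" for k
  have S_bl: "bounded_linear (S k)" and S_sc: "a \<in> K \<Longrightarrow> S k (sc a v) = sc a (S k v)" for k a v
    using assms(7)[rule_format, of "Suc k"] unfolding S_def bounded_operators_def by auto
  have "\<exists>z. filterlim (\<lambda>k. norm (S k z)) at_top sequentially"
    using assms(8)
  proof (elim disjE conjE)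
    assume "banach_condition T C"
    then have compl: "complete (UNIV :: 'a set)"
      and fin: "(\<Sum>k. 1 / (ennreal (onorm (S k))) ^ 1) < \<infinity>"
      by (simp_all add: banach_condition_def banach_space_def S_def)
    show ?thesis
      using banach_orbit_to_infinity[OF compl S_bl]
        ennreal_reciprocal_series[OF onorm_pos_le[OF S_bl] _ fin] by simp
  next
    assume H: "hilbert_condition K sc T C"
    then have K: "K = UNIV" and compl: "complete (UNIV :: 'a set)"
      and fin: "(\<Sum>k. 1 / (ennreal (onorm (S k))) ^ 2) < \<infinity>"
      by (simp_all add: hilbert_condition_def complex_hilbert_space_def banach_space_def S_def)
    from H obtain ip :: "'a \<Rightarrow> 'a \<Rightarrow> complex" where ip:
      "\<forall>x y z. ip (x + y) z = ip x z + ip y z"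
      "\<forall>a x y. ip (sc a x) y = a * ip x y"
      "\<forall>x y. ip y x = cnj (ip x y)"
      "\<forall>x. ip x x = of_real ((norm x)\<^sup>2)"
      unfolding hilbert_condition_def complex_hilbert_space_def by blast
    interpret complex_hilbert sc ip
      using compl normed_space_over.sc_of_real[OF assms(1)] ip by unfold_locales blast+
    show ?thesis
      using hilbert_orbit_to_infinity[OF S_bl]
        ennreal_reciprocal_series[OF onorm_pos_le[OF S_bl] _ fin] S_sc K by simp
  qed
  then show ?thesis
    unfolding S_def comp_def
    by (subst (asm) filterlim_sequentially_Suc[where f = "\<lambda>k. norm ((T ^^ k) (C _))"])
qed

end
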